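(* Let $\mathsf{G}$ be a finitely generated group acting by homeomorphisms on a compact metrizable space $Y$, let $\mathsf{H}\triangleleft \mathsf{G}$ be a normal subgroup with $\mathsf{G}/\mathsf{H}\cong\mathbb{Z}^k$ where $k\in\{1,2\}$, and let $|\cdot|$ denote a word length on $\mathsf{G}$ with respect to some fixed finite generating set. Suppose $\mathsf{m}$ is a symmetric probability measure on $\mathsf{G}$ whose support generates $\mathsf{G}$ as a group and $\nu$ is an $\mathsf{m}$-stationary measure on $Y$. If $\mathsf{m}$ has finite $k^{th}$ moment for $|\cdot|$, i.e. $\sum_{g\in \mathsf{G}}|g|^k\,\mathsf{m}(g)<+\infty$, then there exists a symmetric probability measure $\mathsf{m}'$ on $\mathsf{H}$ whose support generates $\mathsf{H}$ as a group and such that $\mathsf{m}'*\nu=\nu$.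
   Context: A probability measure $\mathsf{m}$ on a group is symmetric if $\mathsf{m}(g)=\mathsf{m}(g^{-1})$ for all $g$. A Borel probability measure $\nu$ on $Y$ is $\mathsf{m}$-stationary if $\mathsf{m}*\nu=\nu$, where $\mathsf{m}*\nu:=\sum_{g}\mathsf{m}(g)\,g_*\nu$. *)

theory Defs
  imports
    "HOL-Probability.Probability"
    "HOL-Algebra.Group_Action"
    "HOL-Algebra.Product_Groups"
begin

(* Generators and their inverses are both allowed as letters.  The value is meaningful only
   for g in generate G S (LEAST over an empty set of lengths is unspecified). *)
definition word_length :: "('g, 'b) monoid_scheme \<Rightarrow> 'g set \<Rightarrow> 'g \<Rightarrow> nat" where
  "word_length G S g =
     (LEAST n. \<exists>w. length w = n \<and> set w \<subseteq> S \<union> (\<lambda>s. inv\<^bsub>G\<^esub> s) ` S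
                  \<and> foldr (\<lambda>x y. x \<otimes>\<^bsub>G\<^esub> y) w \<one>\<^bsub>G\<^esub> = g)"

(* Probability measures on a countable group, or on a subgroup of it, are given by a pmf on the
   underlying type whose support is contained in the (sub)group. *)
definition symmetric_pmf :: "('g, 'b) monoid_scheme \<Rightarrow> 'g pmf \<Rightarrow> bool" where
  "symmetric_pmf G m \<longleftrightarrow> (\<forall>g\<in>carrier G. pmf m (inv\<^bsub>G\<^esub> g) = pmf m g)"

definition borel_algebra :: "'y topology \<Rightarrow> 'y measure" where
  "borel_algebra Y = sigma (topspace Y) {U. openin Y U}"

definition homeomorphic_action ::
    "('g, 'b) monoid_scheme \<Rightarrow> 'y topology \<Rightarrow> ('g \<Rightarrow> 'y \<Rightarrow> 'y) \<Rightarrow> bool" where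
  "homeomorphic_action G Y \<phi> \<longleftrightarrow>
     group_action G (topspace Y) \<phi> \<and> (\<forall>g\<in>carrier G. homeomorphic_map Y Y (\<phi> g))"

(* m * nu = sum over g of m(g) g_* nu.  The sum is written as an integral over the counting
   measure; group elements outside the support of m contribute 0. *)
definition convolution_action ::
    "('g \<Rightarrow> 'y \<Rightarrow> 'y) \<Rightarrow> 'g pmf \<Rightarrow> 'y measure \<Rightarrow> 'y measure" where
  "convolution_action \<phi> m \<nu> =
     measure_of (space \<nu>) (sets \<nu>)
       (\<lambda>A. \<integral>\<^sup>+ g. ennreal (pmf m g) * emeasure (distr \<nu> \<nu> (\<phi> g)) A \<partial>count_space UNIV)"

definition stationary ::
    "('g \<Rightarrow> 'y \<Rightarrow> 'y) \<Rightarrow> 'g pmf \<Rightarrow> 'y measure \<Rightarrow> bool" where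
  "stationary \<phi> m \<nu> \<longleftrightarrow> convolution_action \<phi> m \<nu> = \<nu>"

lemma space_convolution_action [simp]: "space (convolution_action \<phi> m \<nu>) = space \<nu>"
  by (simp add: convolution_action_def)

lemma sets_convolution_action [simp]: "sets (convolution_action \<phi> m \<nu>) = sets \<nu>"
  by (simp add: convolution_action_def)

(* The set function in convolution_action is a measure, so measure_of does not default to 0. *)
lemma emeasure_convolution_action:
  fixes \<phi> :: "'g \<Rightarrow> 'y \<Rightarrow> 'y"
  assumes "A \<in> sets \<nu>"
  shows "emeasure (convolution_action \<phi> m \<nu>) A =
    (\<integral>\<^sup>+ g. ennreal (pmf m g) * emeasure (distr \<nu> \<nu> (\<phi> g)) A \<partial>count_space UNIV)"
proof (rule emeasure_measure_of[OF convolution_action_def])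
  show "sets \<nu> \<subseteq> Pow (space \<nu>)"
    by (rule sets.space_closed)
  show "A \<in> sets (convolution_action \<phi> m \<nu>)"
    using assms by simp
  show "positive (sets (convolution_action \<phi> m \<nu>))
    (\<lambda>A. \<integral>\<^sup>+ g. ennreal (pmf m g) * emeasure (distr \<nu> \<nu> (\<phi> g)) A \<partial>count_space UNIV)"
    by (simp add: positive_def)
  show "countably_additive (sets (convolution_action \<phi> m \<nu>))
    (\<lambda>A. \<integral>\<^sup>+ g. ennreal (pmf m g) * emeasure (distr \<nu> \<nu> (\<phi> g)) A \<partial>count_space UNIV)"
  proof (rule countably_additiveI)
    fix B :: "nat \<Rightarrow> 'y set"
    assume B: "range B \<subseteq> sets (convolution_action \<phi> m \<nu>)" "disjoint_family B"
    have "(\<Sum>i. emeasure (distr \<nu> \<nu> (\<phi> g)) (B i)) = emeasure (distr \<nu> \<nu> (\<phi> g)) (\<Union>i. B i)" for g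
      using B by (intro suminf_emeasure) auto
    then show "(\<Sum>i. \<integral>\<^sup>+ g. ennreal (pmf m g) * emeasure (distr \<nu> \<nu> (\<phi> g)) (B i) \<partial>count_space UNIV)
      = (\<integral>\<^sup>+ g. ennreal (pmf m g) * emeasure (distr \<nu> \<nu> (\<phi> g)) (\<Union>i. B i) \<partial>count_space UNIV)"
      by (simp add: nn_integral_suminf[symmetric])
  qed
qed

end

theory Submission
  imports Defs
begin

text \<open>The measure \<open>m'\<close> is the law of the first return to \<open>H\<close> of the right random walk with step
  distribution \<open>m\<close>. It is a probability measure because the projected symmetric walk on
  \<open>\<int>\<^sup>k\<close> is recurrent, it is symmetric by reversing paths, its support generates \<open>H\<close> since a word
  representing an element of \<open>H\<close> can be cut at its returns to \<open>H\<close>, and \<open>m' * \<nu> = \<nu>\<close> is optional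
  stopping for the bounded harmonic functions \<open>g \<mapsto> \<nu> (g\<^sup>-\<^sup>1 A)\<close>.

  Recurrence is derived from the Dirichlet form: if finitely supported functions \<open>f\<^sub>n\<close> with
  \<open>f\<^sub>n 0 = 1\<close> have energy tending to \<open>0\<close>, the escape probability vanishes. Under a first moment
  on \<open>\<int>\<close> tent functions work, under a second moment on \<open>\<int>\<^sup>2\<close> logarithmic cutoffs do.\<close>

section \<open>Recurrence from the Dirichlet form\<close>

text \<open>The mean of \<open>translation_energy f\<close> under the step law is twice the
  Dirichlet form, so each estimate concerns a single translation \<open>z\<close>, and dominated
  convergence in \<open>z\<close> does the rest. This is where the moment enters. A tent of width
  \<open>n\<close> has energy at most of the order of the smaller of \<open>z^2 / n\<close> and
  \<open>n\<close>: it tends to \<open>0\<close> for fixed \<open>z\<close> and stays below a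
  multiple of \<open>|z|\<close> for all \<open>n\<close>, which a first moment controls although
  the steps may have infinite variance. In rank two the energy of a tent does not decay, since the
  number of points grows as fast as the squared slope shrinks; a slope like \<open>1 / r\<close>
  gains a logarithm, with a quadratic dominating function.

  The walk multiplies on the right so that left translation by \<open>H\<close> preserves both the
  path weights and the set to be avoided. Excursions from any point of \<open>H\<close> are then
  translates of excursions from the identity, which serves symmetry and generation alike. Path
  weights live in \<open>ennreal\<close>, so sums over intermediate points can be interchanged
  freely.\<close>

definition translation_energy :: "('a::ab_group_add \<Rightarrow> real) \<Rightarrow> 'a \<Rightarrow> real" where
  "translation_energy f z = (\<Sum>\<^sub>\<infinity>x. (f (x + z) - f x)\<^sup>2)"

text \<open>The starting time does not count: \<open>avoidance_prob p n c\<close> concerns times \<open>1, \<dots>, n\<close> only, so that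
  \<open>avoidance_prob p n 0\<close> is the probability of no return to the origin up to time \<open>n\<close>.\<close>

primrec avoidance_prob :: "'a::ab_group_add pmf \<Rightarrow> nat \<Rightarrow> 'a \<Rightarrow> real" where
  "avoidance_prob p 0 c = 1"
| "avoidance_prob p (Suc n) c =
     measure_pmf.expectation p (\<lambda>z. if c + z = 0 then 0 else avoidance_prob p n (c + z))"

lemma integrable_pmf_bounded:
  fixes f :: "'a \<Rightarrow> real"
  assumes "\<And>x. \<bar>f x\<bar> \<le> B"
  shows "integrable (measure_pmf p) f"
  by (rule measure_pmf.integrable_const_bound[where B = B]) (use assms in auto)

lemma infsum_translate:
  fixes g :: "'a::ab_group_add \<Rightarrow> real"
  shows "(\<Sum>\<^sub>\<infinity>x. g (x + z)) = infsum g UNIV"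
  by (rule infsum_reindex_bij_betw) (simp add: bij_plus_right)

lemma finite_translate_support:
  fixes g :: "'a::ab_group_add \<Rightarrow> real"
  assumes "finite {x. g x \<noteq> 0}"
  shows "finite {x. g (x + z) \<noteq> 0}"
proof -
  have "{x. g (x + z) \<noteq> 0} \<subseteq> (\<lambda>x. x - z) ` {x. g x \<noteq> 0}"
    by (auto intro: image_eqI[where x = "_ + z"])
  then show ?thesis
    using assms by (rule finite_subset[OF _ finite_imageI])
qed

lemma summable_on_finite_support:
  fixes g :: "'a \<Rightarrow> real"
  assumes "finite A" and "\<And>x. x \<notin> A \<Longrightarrow> g x = 0"
  shows "g summable_on UNIV"
  by (rule finite_nonzero_values_imp_summable_on, rule finite_subset[OF _ assms(1)])
     (use assms(2) in auto)

lemma infsum_finite_support: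
  fixes g :: "'a \<Rightarrow> real"
  assumes "finite A" and "\<And>x. x \<notin> A \<Longrightarrow> g x = 0"
  shows "infsum g UNIV = sum g A"
  using assms by (subst infsum_cong_neutral[of A UNIV g g]) auto

section \<open>Avoidance probabilities and their limit\<close>

lemma avoidance_prob_bounds: "0 \<le> avoidance_prob p n c \<and> avoidance_prob p n c \<le> 1"
proof (induction n arbitrary: c)
  case (Suc n)
  let ?f = "\<lambda>z. if c + z = 0 then 0 else avoidance_prob p n (c + z)"
  have f: "0 \<le> ?f z" "?f z \<le> 1" for z
    using Suc by auto
  have "measure_pmf.expectation p ?f \<le> measure_pmf.expectation p (\<lambda>_. 1)"
    by (intro integral_mono integrable_pmf_bounded[where B = 1]) (use f in auto)
  with f show ?case
    by simp
qed simp

lemma avoidance_prob_Suc_le: "avoidance_prob p (Suc n) c \<le> avoidance_prob p n c"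
proof (induction n arbitrary: c)
  case 0
  show ?case
    using avoidance_prob_bounds[of p "Suc 0" c] by simp
next
  case (Suc n)
  have "measure_pmf.expectation p (\<lambda>z. if c + z = 0 then 0 else avoidance_prob p (Suc n) (c + z))
     \<le> measure_pmf.expectation p (\<lambda>z. if c + z = 0 then 0 else avoidance_prob p n (c + z))"
    by (intro integral_mono integrable_pmf_bounded[where B = 1])
       (use Suc avoidance_prob_bounds[of p] in \<open>auto simp del: avoidance_prob.simps\<close>)
  then show ?case
    by simp
qed

text \<open>Dominated convergence carries the one-step recursion over to the escape probability.
  Killing happens after the step, so the equation holds at \<open>c = 0\<close> too; away from the
  origin it says that \<open>L\<close>, set to zero at the origin, is harmonic.\<close>

lemma avoidance_prob_limit:
  "\<exists>L. \<forall>c. (\<lambda>n. avoidance_prob p n c) \<longlonglongrightarrow> L c \<and> 0 \<le> L c \<and> L c \<le> 1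
    \<and> L c = measure_pmf.expectation p (\<lambda>z. if c + z = 0 then 0 else L (c + z))"
proof -
  define L where "L c = lim (\<lambda>n. avoidance_prob p n c)" for c
  have L: "(\<lambda>n. avoidance_prob p n c) \<longlonglongrightarrow> L c" for c
  proof -
    have "decseq (\<lambda>n. avoidance_prob p n c)"
      by (intro decseq_SucI avoidance_prob_Suc_le)
    then obtain l where "(\<lambda>n. avoidance_prob p n c) \<longlonglongrightarrow> l"
      using avoidance_prob_bounds[of p] by (metis decseq_convergent)
    then show ?thesis
      by (simp add: L_def limI)
  qed
  have bounds: "0 \<le> L c" "L c \<le> 1" for c
    using LIMSEQ_le_const[OF L, of 0 c] LIMSEQ_le_const2[OF L, of c 1] avoidance_prob_bounds[of p]
    by auto
  have "L c = measure_pmf.expectation p (\<lambda>z. if c + z = 0 then 0 else L (c + z))" for c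
  proof (rule LIMSEQ_unique)
    show "(\<lambda>n. avoidance_prob p (Suc n) c) \<longlonglongrightarrow> L c"
      using L by (rule LIMSEQ_Suc)
    show "(\<lambda>n. avoidance_prob p (Suc n) c)
        \<longlonglongrightarrow> measure_pmf.expectation p (\<lambda>z. if c + z = 0 then 0 else L (c + z))"
      unfolding avoidance_prob.simps
    proof (rule integral_dominated_convergence[where w = "\<lambda>_. 1"])
      show "AE z in measure_pmf p. (\<lambda>n. if c + z = 0 then 0 else avoidance_prob p n (c + z))
          \<longlonglongrightarrow> (if c + z = 0 then 0 else L (c + z))"
        using L by auto
    qed (use avoidance_prob_bounds[of p] in auto)
  qed
  with L bounds show ?thesis
    by (intro exI[of _ L] allI conjI)
qed

section \<open>Energy as a function of the translation\<close>

lemma translation_energy_eq: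
  assumes "finite {x. f x \<noteq> 0}"
  shows "translation_energy f z
    = 2 * (\<Sum>x | f x \<noteq> 0. (f x)\<^sup>2) - 2 * (\<Sum>x | f x \<noteq> 0. f x * f (x + z))"
proof -
  let ?A = "{x. f x \<noteq> 0}"
  have s1: "(\<lambda>x. (f x)\<^sup>2) summable_on UNIV" "(\<lambda>x. f x * f (x + z)) summable_on UNIV"
    by (rule summable_on_finite_support[OF assms]; simp)+
  have s2: "(\<lambda>x. (f (x + z))\<^sup>2) summable_on UNIV"
    by (rule summable_on_finite_support[OF finite_translate_support[OF assms, of z]]) simp
  have "translation_energy f z
      = (\<Sum>\<^sub>\<infinity>x. (f (x + z))\<^sup>2 + ((f x)\<^sup>2 + (-2) * (f x * f (x + z))))"
    unfolding translation_energy_def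
    by (intro infsum_cong) (simp add: power2_eq_square algebra_simps)
  also have "\<dots> = (\<Sum>\<^sub>\<infinity>x. (f (x + z))\<^sup>2) + (\<Sum>\<^sub>\<infinity>x. (f x)\<^sup>2) + (-2) * (\<Sum>\<^sub>\<infinity>x. f x * f (x + z))"
    using s1 s2
    by (simp only: infsum_add summable_on_add summable_on_cmult_right infsum_cmult_right' add.assoc)
  also have "(\<Sum>\<^sub>\<infinity>x. (f (x + z))\<^sup>2) = (\<Sum>\<^sub>\<infinity>x. (f x)\<^sup>2)"
    by (rule infsum_translate[of "\<lambda>x. (f x)\<^sup>2"])
  also have "(\<Sum>\<^sub>\<infinity>x. (f x)\<^sup>2) = (\<Sum>x\<in>?A. (f x)\<^sup>2)"
    by (rule infsum_finite_support[OF assms]) simp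
  also have "(\<Sum>\<^sub>\<infinity>x. f x * f (x + z)) = (\<Sum>x\<in>?A. f x * f (x + z))"
    by (rule infsum_finite_support[OF assms]) simp
  finally show ?thesis
    by simp
qed

lemma translation_energy_nonneg: "0 \<le> translation_energy f z"
  unfolding translation_energy_def by (rule infsum_nonneg) simp

text \<open>Being uniform in \<open>z\<close>, this gives integrability of the energy under any step
  law, and it controls long translations in rank one.\<close>

lemma translation_energy_le_norm:
  assumes "finite {x. f x \<noteq> 0}"
  shows "translation_energy f z \<le> 4 * (\<Sum>x | f x \<noteq> 0. (f x)\<^sup>2)"
proof -
  have s1: "(\<lambda>x. (f x)\<^sup>2) summable_on UNIV"
    by (rule summable_on_finite_support[OF assms]) simp
  have s2: "(\<lambda>x. (f (x + z))\<^sup>2) summable_on UNIV"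
    by (rule summable_on_finite_support[OF finite_translate_support[OF assms, of z]]) simp
  have "translation_energy f z \<le> (\<Sum>\<^sub>\<infinity>x. 2 * (f (x + z))\<^sup>2 + 2 * (f x)\<^sup>2)"
    unfolding translation_energy_def
  proof (rule infsum_mono)
    show "(\<lambda>x. (f (x + z) - f x)\<^sup>2) summable_on UNIV"
      by (rule summable_on_finite_support
          [OF finite_UnI[OF assms finite_translate_support[OF assms, of z]]]) simp
    show "(f (x + z) - f x)\<^sup>2 \<le> 2 * (f (x + z))\<^sup>2 + 2 * (f x)\<^sup>2" for x
      using zero_le_power2[of "f (x + z) + f x"] by (simp add: power2_eq_square algebra_simps)
  qed (intro summable_on_add summable_on_cmult_right s1 s2)
  also have "\<dots> = 2 * (\<Sum>\<^sub>\<infinity>x. (f (x + z))\<^sup>2) + 2 * (\<Sum>\<^sub>\<infinity>x. (f x)\<^sup>2)"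
    by (subst infsum_add) (use s1 s2 in \<open>auto intro: summable_on_cmult_right simp: infsum_cmult_right'\<close>)
  also have "(\<Sum>\<^sub>\<infinity>x. (f (x + z))\<^sup>2) = (\<Sum>\<^sub>\<infinity>x. (f x)\<^sup>2)"
    by (rule infsum_translate[of "\<lambda>x. (f x)\<^sup>2"])
  also have "(\<Sum>\<^sub>\<infinity>x. (f x)\<^sup>2) = (\<Sum>x | f x \<noteq> 0. (f x)\<^sup>2)"
    by (rule infsum_finite_support[OF assms]) simp
  finally show ?thesis
    by simp
qed

text \<open>The square root of the energy is the l2 distance of \<open>f\<close> to its translate
  and obeys the triangle inequality. The free weight \<open>t\<close> expresses this without square
  roots and loses nothing when iterated.\<close>

lemma translation_energy_add_le:
  assumes fin: "finite {x. f x \<noteq> 0}" and "t > 0"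
  shows "translation_energy f (y + z)
    \<le> (1 + t) * translation_energy f y + (1 + 1 / t) * translation_energy f z"
proof -
  have s: "(\<lambda>x. (f (x + z) - f x)\<^sup>2) summable_on UNIV" for z
    by (rule summable_on_finite_support
        [OF finite_UnI[OF fin finite_translate_support[OF fin, of z]]]) simp
  have s': "(\<lambda>x. (f (x + z + y) - f (x + z))\<^sup>2) summable_on UNIV"
  proof -
    have "(\<lambda>x. (f (x + z + y) - f (x + z))\<^sup>2) = (\<lambda>x. (\<lambda>x. (f (x + y) - f x)\<^sup>2) (x + z))"
      by simp
    moreover have "finite {x. (f (x + y) - f x)\<^sup>2 \<noteq> 0}"
      by (rule finite_subset[OF _ finite_UnI[OF fin finite_translate_support[OF fin, of y]]]) auto
    ultimately show ?thesis
      using finite_translate_support[of "\<lambda>x. (f (x + y) - f x)\<^sup>2" z]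
      by (auto intro!: finite_nonzero_values_imp_summable_on)
  qed
  have pw: "(a + b)\<^sup>2 \<le> (1 + t) * a\<^sup>2 + (1 + 1 / t) * b\<^sup>2" for a b :: real
  proof -
    have "0 \<le> (t * a - b)\<^sup>2 / t"
      using \<open>t > 0\<close> by simp
    also have "\<dots> = (1 + t) * a\<^sup>2 + (1 + 1 / t) * b\<^sup>2 - (a + b)\<^sup>2"
      using \<open>t > 0\<close> by (simp add: field_simps power2_eq_square)
    finally show ?thesis
      by simp
  qed
  have "translation_energy f (y + z) \<le> (\<Sum>\<^sub>\<infinity>x. (1 + t) * (f (x + z + y) - f (x + z))\<^sup>2
      + (1 + 1 / t) * (f (x + z) - f x)\<^sup>2)"
    unfolding translation_energy_def
  proof (rule infsum_mono)
    show "(f (x + (y + z)) - f x)\<^sup>2 \<le> (1 + t) * (f (x + z + y) - f (x + z))\<^sup>2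
        + (1 + 1 / t) * (f (x + z) - f x)\<^sup>2" for x
      using pw[of "f (x + z + y) - f (x + z)" "f (x + z) - f x"] by (simp add: algebra_simps)
  qed (intro summable_on_add summable_on_cmult_right s s')+
  also have "\<dots> = (1 + t) * (\<Sum>\<^sub>\<infinity>x. (f (x + z + y) - f (x + z))\<^sup>2)
      + (1 + 1 / t) * (\<Sum>\<^sub>\<infinity>x. (f (x + z) - f x)\<^sup>2)"
    by (subst infsum_add) (use s s' in \<open>auto intro: summable_on_cmult_right simp: infsum_cmult_right'\<close>)
  also have "(\<Sum>\<^sub>\<infinity>x. (f (x + z + y) - f (x + z))\<^sup>2) = (\<Sum>\<^sub>\<infinity>x. (f (x + y) - f x)\<^sup>2)"
    by (rule infsum_translate[of "\<lambda>x. (f (x + y) - f x)\<^sup>2"])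
  finally show ?thesis
    by (simp add: translation_energy_def)
qed

lemma translation_energy_uminus: "translation_energy f (- z) = translation_energy f z"
proof -
  have "translation_energy f (- z) = (\<Sum>\<^sub>\<infinity>x. (f (x + z + - z) - f (x + z))\<^sup>2)"
    unfolding translation_energy_def by (rule infsum_translate[symmetric])
  then show ?thesis
    by (simp add: translation_energy_def power2_commute)
qed

text \<open>AM-GM on each pair \<open>x\<close>, \<open>x + z\<close>, with the ratio of the weights
  as balancing factor; translating the second sum turns it into \<open>M (- z)\<close>.\<close>

lemma sum_ratio_translate_ge:
  fixes f w :: "'a::ab_group_add \<Rightarrow> real"
  assumes fin: "finite {x. f x \<noteq> 0}" and w: "\<And>x. 0 < w x"
  defines "M \<equiv> \<lambda>z. \<Sum>x | f x \<noteq> 0. (f x)\<^sup>2 * w (x + z) / w x"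
  shows "2 * (\<Sum>x | f x \<noteq> 0. f x * f (x + z)) \<le> M z + M (- z)"
proof -
  note fin' = finite_translate_support[OF fin, of z]
  have s: "(\<lambda>x. f x * f (x + z)) summable_on UNIV"
    "(\<lambda>x. (f x)\<^sup>2 * w (x + z) / w x) summable_on UNIV"
    by (rule summable_on_finite_support[OF fin]; simp)+
  have s': "(\<lambda>x. (f (x + z))\<^sup>2 * w x / w (x + z)) summable_on UNIV"
    by (rule summable_on_finite_support[OF fin']) simp
  have M1: "M z = (\<Sum>\<^sub>\<infinity>x. (f x)\<^sup>2 * w (x + z) / w x)"
    unfolding M_def by (rule infsum_finite_support[OF fin, symmetric]) simp
  have "M (- z) = (\<Sum>\<^sub>\<infinity>x. (f x)\<^sup>2 * w (x + - z) / w x)"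
    unfolding M_def by (rule infsum_finite_support[OF fin, symmetric]) simp
  also have "\<dots> = (\<Sum>\<^sub>\<infinity>x. (f (x + z))\<^sup>2 * w (x + z + - z) / w (x + z))"
    by (rule infsum_translate[symmetric])
  finally have M2: "M (- z) = (\<Sum>\<^sub>\<infinity>x. (f (x + z))\<^sup>2 * w x / w (x + z))"
    by simp
  have pw: "2 * (f x * f (x + z)) \<le> (f x)\<^sup>2 * w (x + z) / w x + (f (x + z))\<^sup>2 * w x / w (x + z)" for x
  proof -
    have "0 \<le> (f x * w (x + z) - f (x + z) * w x)\<^sup>2 / (w x * w (x + z))"
      using w[of x] w[of "x + z"] by simp
    also have "\<dots> = (f x)\<^sup>2 * w (x + z) / w x + (f (x + z))\<^sup>2 * w x / w (x + z) - 2 * (f x * f (x + z))"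
      using w[of x] w[of "x + z"] by (simp add: field_simps power2_eq_square)
    finally show ?thesis
      by simp
  qed
  have "2 * (\<Sum>x | f x \<noteq> 0. f x * f (x + z)) = (\<Sum>\<^sub>\<infinity>x. 2 * (f x * f (x + z)))"
    unfolding infsum_cmult_right'
    by (subst infsum_finite_support[OF fin]) auto
  also have "\<dots> \<le> (\<Sum>\<^sub>\<infinity>x. (f x)\<^sup>2 * w (x + z) / w x + (f (x + z))\<^sup>2 * w x / w (x + z))"
    by (rule infsum_mono) (use pw s s' in \<open>auto intro: summable_on_cmult_right summable_on_add\<close>)
  also have "\<dots> = M z + M (- z)"
    unfolding M1 M2 by (rule infsum_add) (use s s' in auto)
  finally show ?thesis .
qed

text \<open>Pair the superharmonicity defect of \<open>w\<close> with the test function \<open>f\<^sup>2 / w\<close>. Summation by parts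
  is avoided by averaging over \<open>z\<close> and \<open>-z\<close>, which reduces the claim to the AM-GM bound above.\<close>

lemma escape_le_energy:
  fixes p :: "'a::ab_group_add pmf" and f w :: "'a \<Rightarrow> real"
  assumes sym: "\<And>z. pmf p (- z) = pmf p z"
    and fin: "finite {x. f x \<noteq> 0}"
    and w: "\<And>x. 1 \<le> w x" "\<And>x. w x \<le> 2"
    and super: "\<And>x. measure_pmf.expectation p (\<lambda>z. w (x + z)) \<le> w x"
  shows "(f 0)\<^sup>2 * (w 0 - measure_pmf.expectation p w)
    \<le> measure_pmf.expectation p (translation_energy f)"
proof -
  let ?A = "{x. f x \<noteq> 0}" and ?E = "measure_pmf.expectation p"
  define M where "M z = (\<Sum>x\<in>?A. (f x)\<^sup>2 * w (x + z) / w x)" for z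
  define c where "c z = (\<Sum>x\<in>?A. f x * f (x + z))" for z
  define N where "N = (\<Sum>x\<in>?A. (f x)\<^sup>2)"
  have w0: "0 < w x" for x
    using w(1)[of x] by linarith
  have int_w: "integrable (measure_pmf p) (\<lambda>z. w (x + z))" for x
    by (rule integrable_pmf_bounded[where B = 2]) (use w w0 in \<open>auto simp: abs_of_pos\<close>)
  have int_M: "integrable (measure_pmf p) M"
    unfolding M_def using int_w by auto
  have EM: "?E M = (\<Sum>x\<in>?A. (f x)\<^sup>2 * ?E (\<lambda>z. w (x + z)) / w x)"
    unfolding M_def using int_w by (subst Bochner_Integration.integral_sum) auto
  have p_minus: "map_pmf uminus p = p"
  proof (rule pmf_eqI)
    fix z
    have "pmf (map_pmf uminus p) (- (- z)) = pmf p (- z)"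
      by (rule pmf_map_inj') simp
    then show "pmf (map_pmf uminus p) z = pmf p z"
      using sym by simp
  qed
  \<comment> \<open>Symmetry of the step law makes both halves of the AM-GM bound equal in
    mean.\<close>
  have E_minus: "?E (\<lambda>z. M (- z)) = ?E M"
    using integral_map_pmf[of uminus p M] p_minus by simp
  have int_M': "integrable (measure_pmf p) (\<lambda>z. M (- z))"
    using int_M integrable_map_pmf_eq[of uminus p M] p_minus by simp
  have energy: "translation_energy f z = 2 * N - 2 * c z" for z
    using translation_energy_eq[OF fin] by (simp add: N_def c_def)
  have int_D: "integrable (measure_pmf p) (translation_energy f)"
    by (rule integrable_pmf_bounded[where B = "4 * N"])
       (use translation_energy_le_norm[OF fin] translation_energy_nonneg[of f] in \<open>auto simp: N_def\<close>)
  have "2 * N - ?E (translation_energy f) = ?E (\<lambda>z. 2 * N - translation_energy f z)"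
    using int_D by simp
  also have "\<dots> \<le> ?E (\<lambda>z. M z + M (- z))"
  proof (rule integral_mono)
    show "2 * N - translation_energy f z \<le> M z + M (- z)" for z
      using sum_ratio_translate_ge[OF fin w0, of z] by (simp add: energy c_def M_def)
  qed (use int_D int_M int_M' in auto)
  also have "\<dots> = 2 * ?E M"
    using int_M int_M' E_minus by simp
  finally have *: "2 * (N - ?E M) \<le> ?E (translation_energy f)"
    by simp
  \<comment> \<open>Every defect \<open>w x - ?E (\<lambda>z. w (x + z))\<close> is non-negative, so
    the term at the origin alone is a lower bound.\<close>
  have "N - ?E M = (\<Sum>x\<in>?A. (f x)\<^sup>2 * ((w x - ?E (\<lambda>z. w (x + z))) / w x))"
    unfolding N_def EM sum_subtractf[symmetric]
    by (intro sum.cong) (use w0 in \<open>auto simp: field_simps less_imp_neq[THEN not_sym]\<close>)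
  also have "\<dots> \<ge> (f 0)\<^sup>2 * ((w 0 - ?E w) / w 0)"
  proof (cases "f 0 = 0")
    case False
    have nn: "0 \<le> (f x)\<^sup>2 * ((w x - ?E (\<lambda>z. w (x + z))) / w x)" for x
      using super[of x] w0[of x] by simp
    show ?thesis
      using member_le_sum[of 0 ?A "\<lambda>x. (f x)\<^sup>2 * ((w x - ?E (\<lambda>z. w (x + z))) / w x)"] fin False nn
      by simp
  qed (use super w0 in \<open>auto intro!: sum_nonneg simp: less_imp_le\<close>)
  finally have **: "(f 0)\<^sup>2 * ((w 0 - ?E w) / w 0) \<le> N - ?E M" .
  \<comment> \<open>Dividing by \<open>w 0 \<le> 2\<close> costs a factor 2, which the 2 on the left
    of \<open>*\<close> pays for.\<close>
  define q where "q = (f 0)\<^sup>2 * (w 0 - ?E w)"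
  have "0 \<le> w 0 - ?E w"
    using super[of 0] by simp
  then have "(w 0 - ?E w) / 2 \<le> (w 0 - ?E w) / w 0"
    using w(2)[of 0] w0[of 0] by (intro divide_left_mono) auto
  then have "(f 0)\<^sup>2 * ((w 0 - ?E w) / 2) \<le> (f 0)\<^sup>2 * ((w 0 - ?E w) / w 0)"
    by (intro mult_left_mono) auto
  also note **
  finally have "q / 2 \<le> N - ?E M"
    by (simp add: q_def)
  have "q = 2 * (q / 2)"
    by simp
  also have "\<dots> \<le> 2 * (N - ?E M)"
    using \<open>q / 2 \<le> N - ?E M\<close> by (intro mult_left_mono) auto
  also note *
  finally show ?thesis
    unfolding q_def .
qed

theorem recurrent_if_energy_tendsto_0:
  fixes p :: "'a::ab_group_add pmf" and f :: "nat \<Rightarrow> 'a \<Rightarrow> real"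
  assumes sym: "\<And>z. pmf p (- z) = pmf p z"
    and fin: "\<And>n. finite {x. f n x \<noteq> 0}"
    and f0: "\<And>n. f n 0 = 1"
    and energy: "(\<lambda>n. measure_pmf.expectation p (translation_energy (f n))) \<longlonglongrightarrow> 0"
  shows "(\<lambda>n. avoidance_prob p n 0) \<longlonglongrightarrow> 0"
proof -
  obtain L where *: "\<forall>c. (\<lambda>n. avoidance_prob p n c) \<longlonglongrightarrow> L c \<and> 0 \<le> L c \<and> L c \<le> 1
    \<and> L c = measure_pmf.expectation p (\<lambda>z. if c + z = 0 then 0 else L (c + z))"
    by (rule exE[OF avoidance_prob_limit[of p]])
  have L: "(\<lambda>n. avoidance_prob p n c) \<longlonglongrightarrow> L c" for c
    using spec[OF *, of c] by (elim conjE)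
  have bounds: "0 \<le> L c" "L c \<le> 1" for c
    using spec[OF *, of c] by - (elim conjE, assumption)+
  have eq: "L c = measure_pmf.expectation p (\<lambda>z. if c + z = 0 then 0 else L (c + z))" for c
    using spec[OF *, of c] by (elim conjE)
  \<comment> \<open>\<open>L\<close> may vanish, so the superharmonic function is shifted away from zero to allow division.\<close>
  define w where "w c = 2 - (if c = 0 then 0 else L c)" for c
  have w: "1 \<le> w x" "w x \<le> 2" for x
    using bounds[of x] by (auto simp: w_def)
  have w_zero: "w 0 = 2"
    by (simp add: w_def)
  \<comment> \<open>Hence \<open>w\<close> is harmonic off the origin and its defect at the origin
    is exactly \<open>L 0\<close>: the energy bounds the escape probability itself.\<close>
  have Ew: "measure_pmf.expectation p (\<lambda>z. w (x + z)) = 2 - L x" for x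
  proof -
    have "integrable (measure_pmf p) (\<lambda>z. if x + z = 0 then 0 else L (x + z))"
      by (rule integrable_pmf_bounded[where B = 1]) (use bounds in auto)
    then show ?thesis
      unfolding w_def by (subst eq[of x]) simp
  qed
  have "measure_pmf.expectation p (\<lambda>z. w (x + z)) \<le> w x" for x
    unfolding Ew using bounds[of x] by (auto simp: w_def)
  from escape_le_energy[OF sym fin w this]
  have "(f n 0)\<^sup>2 * (w 0 - measure_pmf.expectation p w)
      \<le> measure_pmf.expectation p (translation_energy (f n))" for n .
  then have "L 0 \<le> measure_pmf.expectation p (translation_energy (f n))" for n
    using Ew[of 0] w_zero by (simp add: f0)
  then have "L 0 \<le> 0"
    by (intro LIMSEQ_le_const[OF energy]) auto
  then have "L 0 = 0"
    using bounds(1)[of 0] by (rule antisym)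
  with L[of 0] show ?thesis
    by simp
qed

section \<open>Test functions of small energy\<close>

text \<open>Induction with weight \<open>t = 1 / n\<close>, since
  \<open>(1 + 1/n) n^2 + (1 + n) = (n + 1)^2\<close>. The sequence \<open>e\<close> stands for the
  multiples of \<open>u\<close>, so that one statement covers integers and each axis of the
  plane.\<close>

lemma translation_energy_multiple_le:
  assumes fin: "finite {x. f x \<noteq> 0}" and e: "e 0 = 0" "\<And>n. e (Suc n) = e n + u"
  shows "translation_energy f (e n) \<le> (real n)\<^sup>2 * translation_energy f u"
proof (induction n)
  case 0
  show ?case
    by (simp add: e translation_energy_def)
next
  case (Suc n)
  show ?case
  proof (cases "n = 0")
    case False
    have "translation_energy f (e (Suc n))
        \<le> (1 + 1 / real n) * translation_energy f (e n)
          + (1 + 1 / (1 / real n)) * translation_energy f u"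
      unfolding e(2) using False by (intro translation_energy_add_le fin) auto
    also have "\<dots> \<le> (1 + 1 / real n) * ((real n)\<^sup>2 * translation_energy f u)
        + (1 + 1 / (1 / real n)) * translation_energy f u"
      by (intro add_right_mono mult_left_mono Suc) auto
    also have "\<dots> = (real (Suc n))\<^sup>2 * translation_energy f u"
      using False by (simp add: field_simps power2_eq_square)
    finally show ?thesis .
  qed (simp add: e)
qed

text \<open>The profile is prescribed through its drops: \<open>\<delta> i\<close> is lost between
  radius \<open>i\<close> and \<open>i + 1\<close>, so energies become sums of squares of
  \<open>\<delta>\<close> over shells.\<close>

definition radial_cutoff :: "nat \<Rightarrow> (nat \<Rightarrow> real) \<Rightarrow> nat \<Rightarrow> real" where
  "radial_cutoff n \<delta> r = (\<Sum>i\<in>{r..<n}. \<delta> i)"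

lemma radial_cutoff_eq_0: "n \<le> r \<Longrightarrow> radial_cutoff n \<delta> r = 0"
  by (simp add: radial_cutoff_def)

lemma radial_cutoff_step:
  "radial_cutoff n \<delta> r - radial_cutoff n \<delta> (Suc r) = (if r < n then \<delta> r else 0)"
  by (auto simp: radial_cutoff_def sum.atLeast_Suc_lessThan)

lemma radial_support_subset: "{x. radial_cutoff n \<delta> (N x) \<noteq> 0} \<subseteq> {x. N x < n}"
proof
  fix x assume "x \<in> {x. radial_cutoff n \<delta> (N x) \<noteq> 0}"
  then show "x \<in> {x. N x < n}"
    by (cases "N x < n") (simp_all add: radial_cutoff_eq_0)
qed

lemma finite_radial_support:
  assumes "finite {x. N x < n}"
  shows "finite {x. radial_cutoff n \<delta> (N x) \<noteq> 0}"
  by (rule finite_subset[OF radial_support_subset assms])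

text \<open>A translation that moves the radius by at most one crosses at most one drop. Charge it
  to whichever of \<open>x\<close>, \<open>x + u\<close> has the smaller radius; each point is
  charged at most twice, whence the factor 2.\<close>

lemma translation_energy_radial_le:
  fixes N :: "'a::ab_group_add \<Rightarrow> nat"
  assumes fin: "finite {x. N x < n}"
    and lip: "\<And>x. N (x + u) \<le> Suc (N x)" "\<And>x. N x \<le> Suc (N (x + u))"
  shows "translation_energy (\<lambda>x. radial_cutoff n \<delta> (N x)) u \<le> 2 * (\<Sum>x | N x < n. (\<delta> (N x))\<^sup>2)"
proof -
  let ?f = "\<lambda>x. radial_cutoff n \<delta> (N x)"
  define d where "d x = (if N x < n then (\<delta> (N x))\<^sup>2 else 0)" for x
  have fin_f: "finite {x. ?f x \<noteq> 0}"
    by (rule finite_radial_support[OF fin])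
  have fin_d: "finite {x. d x \<noteq> 0}"
    by (rule finite_subset[OF _ fin]) (auto simp: d_def)
  have s: "d summable_on UNIV" "(\<lambda>x. d (x + u)) summable_on UNIV"
    using fin_d finite_translate_support[OF fin_d]
    by (auto intro: finite_nonzero_values_imp_summable_on)
  have "translation_energy ?f u \<le> (\<Sum>\<^sub>\<infinity>x. d (x + u) + d x)"
    unfolding translation_energy_def
  proof (rule infsum_mono)
    show "(\<lambda>x. (?f (x + u) - ?f x)\<^sup>2) summable_on UNIV"
      by (rule summable_on_finite_support
          [OF finite_UnI[OF fin_f finite_translate_support[OF fin_f, of u]]]) simp
    show "(?f (x + u) - ?f x)\<^sup>2 \<le> d (x + u) + d x" for x
    proof -
      consider "N (x + u) = N x" | "N (x + u) = Suc (N x)" | "N x = Suc (N (x + u))"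
        using lip[of x] by linarith
      then show ?thesis
      proof cases
        case 2
        then show ?thesis
          using radial_cutoff_step[of n \<delta> "N x"] by (simp add: d_def power2_commute)
      next
        case 3
        then show ?thesis
          using radial_cutoff_step[of n \<delta> "N (x + u)"] by (simp add: d_def)
      qed (simp add: d_def)
    qed
  qed (intro summable_on_add s)
  also have "\<dots> = (\<Sum>\<^sub>\<infinity>x. d (x + u)) + infsum d UNIV"
    using s by (intro infsum_add)
  also have "(\<Sum>\<^sub>\<infinity>x. d (x + u)) = infsum d UNIV"
    by (rule infsum_translate)
  also have "infsum d UNIV = (\<Sum>x | N x < n. (\<delta> (N x))\<^sup>2)"
    by (subst infsum_finite_support[OF fin]) (auto simp: d_def)
  finally show ?thesis
    by simp
qed

section \<open>Rank one: tent functions\<close>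

lemma recurrent_int:
  fixes p :: "int pmf"
  assumes sym: "\<And>z. pmf p (- z) = pmf p z"
    and moment: "integrable (measure_pmf p) (\<lambda>z. real_of_int \<bar>z\<bar>)"
  shows "(\<lambda>n. avoidance_prob p n 0) \<longlonglongrightarrow> 0"
proof (rule recurrent_if_energy_tendsto_0[OF sym])
  \<comment> \<open>This is the tent \<open>1 - |x| / (n + 1)\<close>, cut off at zero.\<close>
  define f :: "nat \<Rightarrow> int \<Rightarrow> real"
    where "f n x = radial_cutoff (Suc n) (\<lambda>_. 1 / real (Suc n)) (nat \<bar>x\<bar>)" for n x
  have ball: "{x::int. nat \<bar>x\<bar> < n} = {- int n<..<int n}" for n
    by auto
  show fin: "finite {x. f n x \<noteq> 0}" for n
    unfolding f_def by (rule finite_radial_support) (simp add: ball)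
  show "f n 0 = 1" for n
    by (simp add: f_def radial_cutoff_def)
  have step: "translation_energy (f n) 1 \<le> 4 / real (Suc n)" for n
  proof -
    have "translation_energy (f n) 1 \<le> 2 * (\<Sum>x | nat \<bar>x::int\<bar> < Suc n. (1 / real (Suc n))\<^sup>2)"
      unfolding f_def by (rule translation_energy_radial_le) (auto simp: ball)
    also have "\<dots> = 2 * (real (2 * n + 1) * (1 / real (Suc n))\<^sup>2)"
      by (simp add: ball)
    also have "\<dots> \<le> 2 * (2 * real (Suc n) * (1 / real (Suc n))\<^sup>2)"
      by (intro mult_left_mono mult_right_mono) auto
    also have "\<dots> = 4 / real (Suc n)"
      by (simp add: power2_eq_square del: of_nat_Suc)
    finally show ?thesis .
  qed
  have quadratic: "translation_energy (f n) z \<le> 4 * (real_of_int z)\<^sup>2 / real (Suc n)" for n z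
  proof -
    have "translation_energy (f n) z = translation_energy (f n) (int (nat \<bar>z\<bar>))"
      by (cases "0 \<le> z") (simp_all add: translation_energy_uminus)
    also have "\<dots> \<le> (real (nat \<bar>z\<bar>))\<^sup>2 * translation_energy (f n) 1"
      by (rule translation_energy_multiple_le[OF fin]) auto
    also have "\<dots> \<le> (real (nat \<bar>z\<bar>))\<^sup>2 * (4 / real (Suc n))"
      by (intro mult_left_mono step) auto
    finally show ?thesis
      by (simp add: mult.commute)
  qed
  \<comment> \<open>The quadratic bound is too weak once \<open>|z|\<close> exceeds the width; the
    squared norm of a function bounded by one on fewer than \<open>2 * Suc n\<close> points takes
    over.\<close>
  have bounded: "translation_energy (f n) z \<le> 8 * real (Suc n)" for n z
  proof -
    have "\<bar>f n x\<bar> \<le> 1" for x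
      by (auto simp: f_def radial_cutoff_def field_simps)
    then have f1: "(f n x)\<^sup>2 \<le> 1" for x
      by (simp add: abs_square_le_1)
    have "translation_energy (f n) z \<le> 4 * (\<Sum>x | f n x \<noteq> 0. (f n x)\<^sup>2)"
      by (rule translation_energy_le_norm[OF fin])
    also have "(\<Sum>x | f n x \<noteq> 0. (f n x)\<^sup>2) \<le> (\<Sum>x\<in>{- int (Suc n)<..<int (Suc n)}. 1)"
    proof (rule order_trans[OF sum_mono sum_mono2])
      show "{x. f n x \<noteq> 0} \<subseteq> {- int (Suc n)<..<int (Suc n)}"
        unfolding ball[symmetric] f_def by (rule radial_support_subset)
    qed (use f1 in auto)
    also have "\<dots> \<le> real (2 * Suc n)"
      by (simp add: nat_add_distrib)
    finally show ?thesis
      by simp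
  qed
  \<comment> \<open>Only a first moment is available, so the two bounds above are interpolated at \<open>\<bar>z\<bar> = n + 1\<close>.\<close>
  have linear: "translation_energy (f n) z \<le> 8 * real_of_int \<bar>z\<bar>" for n z
  proof (cases "\<bar>z\<bar> \<le> int (Suc n)")
    case True
    have "4 * (real_of_int z)\<^sup>2 / real (Suc n) = 4 * real_of_int \<bar>z\<bar> * (real_of_int \<bar>z\<bar> / real (Suc n))"
      by (simp add: power2_eq_square)
    also have "\<dots> \<le> 4 * real_of_int \<bar>z\<bar> * 1"
      using True by (intro mult_left_mono) (auto simp: field_simps)
    finally show ?thesis
      using quadratic[of n z] by linarith
  next
    case False
    then have "real_of_int (int (Suc n)) \<le> real_of_int \<bar>z\<bar>"
      by (simp only: of_int_le_iff)
    with bounded[of n z] show ?thesis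
      by simp
  qed
  have pointwise: "(\<lambda>n. translation_energy (f n) z) \<longlonglongrightarrow> 0" for z
  proof (rule tendsto_sandwich[OF _ _ tendsto_const])
    show "(\<lambda>n. 4 * (real_of_int z)\<^sup>2 / real (Suc n)) \<longlonglongrightarrow> 0"
      using tendsto_mult_left[OF LIMSEQ_inverse_real_of_nat, of "4 * (real_of_int z)\<^sup>2"]
      by (simp add: divide_inverse)
  qed (use quadratic in \<open>simp_all add: translation_energy_nonneg del: of_nat_Suc\<close>)
  have "(\<lambda>n. measure_pmf.expectation p (translation_energy (f n)))
      \<longlonglongrightarrow> measure_pmf.expectation p (\<lambda>_. 0 :: real)"
  proof (rule integral_dominated_convergence)
    show "integrable (measure_pmf p) (\<lambda>z. 8 * real_of_int \<bar>z\<bar>)"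
      by (intro integrable_mult_right moment)
    show "AE z in measure_pmf p. norm (translation_energy (f n) z) \<le> 8 * real_of_int \<bar>z\<bar>" for n
      unfolding real_norm_def abs_of_nonneg[OF translation_energy_nonneg]
      by (intro AE_I2 linear)
  qed (use pointwise in auto)
  then show "(\<lambda>n. measure_pmf.expectation p (translation_energy (f n))) \<longlonglongrightarrow> 0"
    by simp
qed

section \<open>Rank two: logarithmic cutoffs\<close>

lemma recurrent_int_prod:
  fixes p :: "(int \<times> int) pmf"
  assumes sym: "\<And>z. pmf p (- z) = pmf p z"
    and moment: "integrable (measure_pmf p) (\<lambda>z. (real_of_int (fst z))\<^sup>2 + (real_of_int (snd z))\<^sup>2)"
  shows "(\<lambda>n. avoidance_prob p n 0) \<longlonglongrightarrow> 0"
proof (rule recurrent_if_energy_tendsto_0[OF sym])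
  define N :: "int \<times> int \<Rightarrow> nat" where "N x = max (nat \<bar>fst x\<bar>) (nat \<bar>snd x\<bar>)" for x
  \<comment> \<open>Normalising by a harmonic number rather than a logarithm makes
    \<open>f n 0 = 1\<close> exact.\<close>
  define h :: "nat \<Rightarrow> real" where "h n = harm (Suc n)" for n
  \<comment> \<open>A logarithmic cutoff: shells have about \<open>8 r\<close> points and gradient \<open>1 / (r log n)\<close>.\<close>
  define \<delta> where "\<delta> n i = 1 / (real (Suc i) * h n)" for n i
  define f where "f n x = radial_cutoff (Suc n) (\<delta> n) (N x)" for n x
  have h1: "1 \<le> h n" for n
    using harm_mono[of 1 "Suc n"] by (simp add: h_def harm_def)
  have h_sum: "(\<Sum>i<Suc n. 1 / real (Suc i)) = h n" for n
    unfolding h_def harm_def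
    by (rule sum.reindex_bij_witness[of _ "\<lambda>i. i - 1" Suc]) (auto simp: inverse_eq_divide)
  have N_le_Suc: "N (a, b) \<le> Suc (N (c, d))"
    if "nat \<bar>a\<bar> \<le> Suc (nat \<bar>c\<bar>)" "nat \<bar>b\<bar> \<le> Suc (nat \<bar>d\<bar>)" for a b c d
    using max.mono[OF that] by (simp add: N_def)
  have ball: "{x. N x < n} \<subseteq> {- int n..int n} \<times> {- int n..int n}" for n
    by (auto simp: N_def)
  have fin_ball: "finite {x. N x < n}" for n
    by (rule finite_subset[OF ball]) simp
  \<comment> \<open>A sphere of the maximum norm is covered by four sides of
    \<open>2 * r + 1\<close> points each.\<close>
  have shell: "real (card {x. N x = r}) \<le> 8 * real (Suc r)" for r
  proof -
    have "{x. N x = r} \<subseteq> {int r, - int r} \<times> {- int r..int r} \<union> {- int r..int r} \<times> {int r, - int r}"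
      (is "_ \<subseteq> ?B")
    proof
      fix x assume "x \<in> {x. N x = r}"
      then obtain a b where "x = (a, b)" "max (nat \<bar>a\<bar>) (nat \<bar>b\<bar>) = r"
        by (cases x) (simp add: N_def)
      then have "x = (a, b)" "nat \<bar>a\<bar> = r \<and> nat \<bar>b\<bar> \<le> r \<or> nat \<bar>b\<bar> = r \<and> nat \<bar>a\<bar> \<le> r"
        by linarith+
      then show "x \<in> ?B"
        by auto
    qed
    then have "card {x. N x = r} \<le> card ?B"
      by (intro card_mono) auto
    also have "\<dots> \<le> card ({int r, - int r} \<times> {- int r..int r}) + card ({- int r..int r} \<times> {int r, - int r})"
      by (rule card_Un_le)
    also have "\<dots> \<le> 2 * (2 * r + 1) + (2 * r + 1) * 2"
      unfolding card_cartesian_product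
      by (intro add_mono mult_mono) (auto simp: card_insert_if nat_add_distrib)
    finally show ?thesis
      by simp
  qed
  show fin: "finite {x. f n x \<noteq> 0}" for n
    unfolding f_def by (rule finite_radial_support[OF fin_ball])
  show "f n 0 = 1" for n
    using h1[of n] h_sum[of n]
    by (simp add: f_def N_def radial_cutoff_def \<delta>_def atLeast0LessThan sum_divide_distrib[symmetric]
        del: sum.lessThan_Suc of_nat_Suc flip: divide_divide_eq_left)
  have step: "translation_energy (f n) u \<le> 16 / h n" if "u = (1, 0) \<or> u = (0, 1)" for n u
  proof -
    have "N (x + u) \<le> Suc (N x)" "N x \<le> Suc (N (x + u))" for x
      using that by (cases x; auto intro!: N_le_Suc)+
    then have "translation_energy (f n) u \<le> 2 * (\<Sum>x | N x < Suc n. (\<delta> n (N x))\<^sup>2)"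
      unfolding f_def by (intro translation_energy_radial_le fin_ball)
    also have "(\<Sum>x | N x < Suc n. (\<delta> n (N x))\<^sup>2)
        = (\<Sum>r<Suc n. \<Sum>x | x \<in> {x. N x < Suc n} \<and> N x = r. (\<delta> n (N x))\<^sup>2)"
      by (rule sum.group[symmetric]) (use fin_ball in auto)
    also have "\<dots> = (\<Sum>r<Suc n. real (card {x. N x = r}) * (\<delta> n r)\<^sup>2)"
    proof (rule sum.cong[OF refl])
      fix r assume "r \<in> {..<Suc n}"
      then have "{x. x \<in> {x. N x < Suc n} \<and> N x = r} = {x. N x = r}"
        by auto
      then show "(\<Sum>x | x \<in> {x. N x < Suc n} \<and> N x = r. (\<delta> n (N x))\<^sup>2)
          = real (card {x. N x = r}) * (\<delta> n r)\<^sup>2"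
        by simp
    qed
    also have "\<dots> \<le> (\<Sum>r<Suc n. 8 * real (Suc r) * (\<delta> n r)\<^sup>2)"
      by (intro sum_mono mult_right_mono shell) auto
    \<comment> \<open>Shell size times squared slope leaves \<open>1 / Suc r\<close>, so the sum is
      a single harmonic number against the two in the denominator.\<close>
    also have "\<dots> = (\<Sum>r<Suc n. 8 / (h n)\<^sup>2 * (1 / real (Suc r)))"
      by (intro sum.cong) (auto simp: \<delta>_def power2_eq_square field_simps simp del: of_nat_Suc)
    also have "\<dots> = 8 / (h n)\<^sup>2 * h n"
      by (simp only: sum_distrib_left[symmetric] h_sum)
    also have "\<dots> = 8 / h n"
      using h1[of n] by (simp add: power2_eq_square)
    finally show ?thesis
      by simp
  qed
  have quadratic: "translation_energy (f n) z
      \<le> 32 * ((real_of_int (fst z))\<^sup>2 + (real_of_int (snd z))\<^sup>2) / h n" for n z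
  proof -
    have fst_le: "translation_energy (f n) (a, 0) \<le> (real_of_int a)\<^sup>2 * (16 / h n)" for a
    proof -
      have "translation_energy (f n) (a, 0) = translation_energy (f n) (int (nat \<bar>a\<bar>), 0)"
        using translation_energy_uminus[of "f n" "(a, 0)"] by (cases "0 \<le> a") simp_all
      also have "\<dots> \<le> (real (nat \<bar>a\<bar>))\<^sup>2 * translation_energy (f n) (1, 0)"
        by (rule translation_energy_multiple_le[OF fin]) (auto simp: zero_prod_def)
      also have "\<dots> \<le> (real (nat \<bar>a\<bar>))\<^sup>2 * (16 / h n)"
        by (intro mult_left_mono step) auto
      finally show ?thesis
        by simp
    qed
    have snd_le: "translation_energy (f n) (0, a) \<le> (real_of_int a)\<^sup>2 * (16 / h n)" for a
    proof -
      have "translation_energy (f n) (0, a) = translation_energy (f n) (0, int (nat \<bar>a\<bar>))"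
        using translation_energy_uminus[of "f n" "(0, a)"] by (cases "0 \<le> a") simp_all
      also have "\<dots> \<le> (real (nat \<bar>a\<bar>))\<^sup>2 * translation_energy (f n) (0, 1)"
        by (rule translation_energy_multiple_le[OF fin]) (auto simp: zero_prod_def)
      also have "\<dots> \<le> (real (nat \<bar>a\<bar>))\<^sup>2 * (16 / h n)"
        by (intro mult_left_mono step) auto
      finally show ?thesis
        by simp
    qed
    \<comment> \<open>One axis at a time; the weight \<open>t = 1\<close> gives the factors
      2.\<close>
    have "translation_energy (f n) z
        \<le> 2 * translation_energy (f n) (fst z, 0) + 2 * translation_energy (f n) (0, snd z)"
      using translation_energy_add_le[OF fin, of 1 n "(fst z, 0)" "(0, snd z)"] by simp
    also have "\<dots> \<le> 2 * ((real_of_int (fst z))\<^sup>2 * (16 / h n)) + 2 * ((real_of_int (snd z))\<^sup>2 * (16 / h n))"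
      by (intro add_mono mult_left_mono fst_le snd_le) auto
    also have "\<dots> = 32 * ((real_of_int (fst z))\<^sup>2 + (real_of_int (snd z))\<^sup>2) / h n"
      by (simp add: field_simps add_divide_distrib)
    finally show ?thesis .
  qed
  have dominated: "translation_energy (f n) z
      \<le> 32 * ((real_of_int (fst z))\<^sup>2 + (real_of_int (snd z))\<^sup>2)" for n z
  proof -
    have "32 * ((real_of_int (fst z))\<^sup>2 + (real_of_int (snd z))\<^sup>2) / h n
        \<le> 32 * ((real_of_int (fst z))\<^sup>2 + (real_of_int (snd z))\<^sup>2) / 1"
      using h1[of n] by (intro divide_left_mono) auto
    with quadratic[of n z] show ?thesis
      by simp
  qed
  have h_lim: "filterlim h at_top sequentially"
    unfolding h_def using harm_at_top by (rule filterlim_compose[OF _ filterlim_Suc])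
  have pointwise: "(\<lambda>n. translation_energy (f n) z) \<longlonglongrightarrow> 0" for z
  proof (rule tendsto_sandwich[OF _ _ tendsto_const])
    show "(\<lambda>n. 32 * ((real_of_int (fst z))\<^sup>2 + (real_of_int (snd z))\<^sup>2) / h n) \<longlonglongrightarrow> 0"
      by (rule real_tendsto_divide_at_top[OF tendsto_const h_lim])
  qed (use quadratic in \<open>simp_all add: translation_energy_nonneg\<close>)
  have "(\<lambda>n. measure_pmf.expectation p (translation_energy (f n)))
      \<longlonglongrightarrow> measure_pmf.expectation p (\<lambda>_. 0 :: real)"
  proof (rule integral_dominated_convergence)
    show "integrable (measure_pmf p)
        (\<lambda>z. 32 * ((real_of_int (fst z))\<^sup>2 + (real_of_int (snd z))\<^sup>2))"
      by (intro integrable_mult_right moment)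
    show "AE z in measure_pmf p. norm (translation_energy (f n) z)
        \<le> 32 * ((real_of_int (fst z))\<^sup>2 + (real_of_int (snd z))\<^sup>2)" for n
      unfolding real_norm_def abs_of_nonneg[OF translation_energy_nonneg]
      by (intro AE_I2 dominated)
  qed (use pointwise in auto)
  then show "(\<lambda>n. measure_pmf.expectation p (translation_energy (f n))) \<longlonglongrightarrow> 0"
    by simp
qed

section \<open>First return to a subgroup\<close>

text \<open>Tonelli for arbitrary index sets, after extension by zero to the whole types.\<close>

lemma nn_integral_count_space_swap:
  fixes f :: "'a \<Rightarrow> 'b \<Rightarrow> ennreal"
  shows "(\<integral>\<^sup>+x. \<integral>\<^sup>+y. f x y \<partial>count_space B \<partial>count_space A) = (\<integral>\<^sup>+y. \<integral>\<^sup>+x. f x y \<partial>count_space A \<partial>count_space B)"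
proof -
  define g where "g = (\<lambda>(x, y). f x y * indicator B y * indicator A x)"
  have "(\<integral>\<^sup>+x. \<integral>\<^sup>+y. f x y \<partial>count_space B \<partial>count_space A)
      = (\<integral>\<^sup>+x. \<integral>\<^sup>+y. g (x, y) \<partial>count_space UNIV \<partial>count_space UNIV)"
    by (simp add: g_def nn_integral_count_space_indicator nn_integral_multc)
  also have "\<dots> = (\<integral>\<^sup>+y. \<integral>\<^sup>+x. g (x, y) \<partial>count_space UNIV \<partial>count_space UNIV)"
    by (simp only: nn_integral_fst_count_space nn_integral_snd_count_space)
  also have "\<dots> = (\<integral>\<^sup>+y. \<integral>\<^sup>+x. f x y \<partial>count_space A \<partial>count_space B)"
    by (simp add: g_def nn_integral_count_space_indicator nn_integral_multc[symmetric])
       (simp add: mult_ac)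
  finally show ?thesis .
qed

lemma nn_integral_count_space_Un_disjoint:
  fixes f :: "'a \<Rightarrow> ennreal"
  assumes "A \<inter> B = {}"
  shows "(\<integral>\<^sup>+x. f x \<partial>count_space (A \<union> B)) = (\<integral>\<^sup>+x. f x \<partial>count_space A) + (\<integral>\<^sup>+x. f x \<partial>count_space B)"
proof -
  have "(\<integral>\<^sup>+x. f x * indicator (A \<union> B) x \<partial>count_space UNIV)
      = (\<integral>\<^sup>+x. f x * indicator A x + f x * indicator B x \<partial>count_space UNIV)"
    using assms by (intro nn_integral_cong) (auto split: split_indicator)
  then show ?thesis
    by (simp add: nn_integral_count_space_indicator nn_integral_add)
qed

locale symmetric_walk = group G for G (structure) +
  fixes H :: "'a set" and m :: "'a pmf"
  assumes subgroup_H: "subgroup H G"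
    and supp: "set_pmf m \<subseteq> carrier G"
    and sym: "symmetric_pmf G m"
begin

text \<open>The kernel of the right walk depends only on the increment
  \<open>inv x \<otimes> y\<close>, which left translations do not change.\<close>

definition step :: "'a \<Rightarrow> 'a \<Rightarrow> ennreal" where
  "step x y = ennreal (pmf m (inv x \<otimes> y))"

text \<open>\<open>taboo n x y\<close> is the weight of the paths of \<open>n + 1\<close> steps from \<open>x\<close> to \<open>y\<close> whose intermediate
  points avoid \<open>H\<close>; the end points are unrestricted.\<close>

primrec taboo :: "nat \<Rightarrow> 'a \<Rightarrow> 'a \<Rightarrow> ennreal" where
  "taboo 0 x y = step x y"
| "taboo (Suc n) x y = (\<integral>\<^sup>+z. taboo n x z * step z y \<partial>count_space (carrier G - H))"

definition first_return :: "'a \<Rightarrow> ennreal" where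
  "first_return h = (\<Sum>n. taboo n \<one> h)"

lemma H_subset: "H \<subseteq> carrier G"
  using subgroup_H by (rule subgroup.subset)

lemma mult_mem_H_iff:
  assumes "g \<in> H" "x \<in> carrier G"
  shows "g \<otimes> x \<in> H \<longleftrightarrow> x \<in> H"
proof
  assume "g \<otimes> x \<in> H"
  then have "inv g \<otimes> (g \<otimes> x) \<in> H"
    using subgroup_H assms(1) by (simp add: subgroup.m_closed subgroup.m_inv_closed)
  moreover have "inv g \<otimes> (g \<otimes> x) = x"
    using assms H_subset by (metis inv_solve_left m_closed subsetD)
  ultimately show "x \<in> H"
    by simp
qed (use assms subgroup_H in \<open>simp add: subgroup.m_closed\<close>)

lemma bij_betw_translate:
  assumes "x \<in> carrier G"
  shows "bij_betw ((\<otimes>) x) (carrier G) (carrier G)"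
  by (rule bij_betw_byWitness[where f' = "(\<otimes>) (inv x)"]) (use assms in \<open>auto simp: m_assoc[symmetric]\<close>)

lemma bij_betw_translate_Diff:
  assumes "g \<in> H"
  shows "bij_betw ((\<otimes>) g) (carrier G - H) (carrier G - H)"
proof (rule bij_betw_byWitness[where f' = "(\<otimes>) (inv g)"])
  have "g \<in> carrier G" "inv g \<in> H"
    using assms H_subset subgroup_H by (auto simp: subgroup.m_inv_closed)
  with assms show "\<forall>a\<in>carrier G - H. inv g \<otimes> (g \<otimes> a) = a"
    "\<forall>a\<in>carrier G - H. g \<otimes> (inv g \<otimes> a) = a"
    "(\<otimes>) g ` (carrier G - H) \<subseteq> carrier G - H"
    "(\<otimes>) (inv g) ` (carrier G - H) \<subseteq> carrier G - H"
    by (auto simp: m_assoc[symmetric] mult_mem_H_iff)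
qed

lemma step_sym:
  assumes "x \<in> carrier G" "y \<in> carrier G"
  shows "step x y = step y x"
proof -
  have "pmf m (inv (inv y \<otimes> x)) = pmf m (inv y \<otimes> x)"
    using sym assms by (simp add: symmetric_pmf_def)
  then show ?thesis
    using assms by (simp add: step_def inv_mult_group)
qed

lemma step_translate:
  assumes "g \<in> carrier G" "x \<in> carrier G" "y \<in> carrier G"
  shows "step (g \<otimes> x) (g \<otimes> y) = step x y"
proof -
  have "inv g \<otimes> (g \<otimes> y) = y"
    using assms by (simp add: m_assoc[symmetric])
  then show ?thesis
    using assms by (simp add: step_def inv_mult_group m_assoc)
qed

text \<open>The substitution \<open>y = x \<otimes> s\<close> turns a sum over end points into an
  average over increments.\<close>

lemma nn_integral_step:
  assumes "x \<in> carrier G"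
  shows "(\<integral>\<^sup>+y. step x y * F y \<partial>count_space (carrier G)) = (\<integral>\<^sup>+s. F (x \<otimes> s) \<partial>measure_pmf m)"
proof -
  have "(\<integral>\<^sup>+y. step x y * F y \<partial>count_space (carrier G))
      = (\<integral>\<^sup>+s. step x (x \<otimes> s) * F (x \<otimes> s) \<partial>count_space (carrier G))"
    by (rule nn_integral_bij_count_space[OF bij_betw_translate[OF assms], symmetric])
  also have "\<dots> = (\<integral>\<^sup>+s. ennreal (pmf m s) * F (x \<otimes> s) \<partial>count_space (carrier G))"
    using assms by (intro nn_integral_cong) (simp add: step_def m_assoc[symmetric])
  also have "\<dots> = (\<integral>\<^sup>+s. ennreal (pmf m s) * F (x \<otimes> s) \<partial>count_space UNIV)"
    unfolding nn_integral_count_space_indicator[of "carrier G", simplified]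
    by (intro nn_integral_cong) (use supp in \<open>auto simp: set_pmf_iff split: split_indicator\<close>)
  finally show ?thesis
    by (simp add: nn_integral_measure_pmf)
qed

text \<open>The definition splits off the last step, this lemma the first; with both at hand, path
  reversal is an induction.\<close>

lemma taboo_Suc_left:
  "taboo (Suc n) x y = (\<integral>\<^sup>+z. step x z * taboo n z y \<partial>count_space (carrier G - H))"
proof (induction n arbitrary: y)
  case (Suc n)
  let ?C = "count_space (carrier G - H)"
  have "taboo (Suc (Suc n)) x y = (\<integral>\<^sup>+z. (\<integral>\<^sup>+w. step x w * taboo n w z \<partial>?C) * step z y \<partial>?C)"
    by (subst taboo.simps(2)) (simp only: Suc)
  also have "\<dots> = (\<integral>\<^sup>+z. \<integral>\<^sup>+w. step x w * taboo n w z * step z y \<partial>?C \<partial>?C)"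
    by (simp add: nn_integral_multc)
  also have "\<dots> = (\<integral>\<^sup>+w. \<integral>\<^sup>+z. step x w * taboo n w z * step z y \<partial>?C \<partial>?C)"
    by (rule nn_integral_count_space_swap)
  also have "\<dots> = (\<integral>\<^sup>+w. step x w * taboo (Suc n) w y \<partial>?C)"
    by (simp add: nn_integral_cmult mult.assoc)
  finally show ?case .
qed simp

text \<open>A reversed path has the same intermediate points and, step by step, the same
  weight.\<close>

lemma taboo_sym:
  "x \<in> carrier G \<Longrightarrow> y \<in> carrier G \<Longrightarrow> taboo n x y = taboo n y x"
proof (induction n arbitrary: x y)
  case (Suc n)
  have "taboo (Suc n) x y = (\<integral>\<^sup>+z. step y z * taboo n z x \<partial>count_space (carrier G - H))"
    unfolding taboo.simps
    by (intro nn_integral_cong) (use Suc in \<open>simp add: step_sym[of y] mult.commute\<close>)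
  then show ?case
    by (simp only: taboo_Suc_left)
qed (simp add: step_sym)

text \<open>The translating element is taken from \<open>H\<close> because it has to permute the
  complement of \<open>H\<close>, where the intermediate points live.\<close>

lemma taboo_translate:
  assumes "g \<in> H"
  shows "x \<in> carrier G \<Longrightarrow> y \<in> carrier G \<Longrightarrow> taboo n (g \<otimes> x) (g \<otimes> y) = taboo n x y"
proof (induction n arbitrary: y)
  case 0
  then show ?case
    using assms H_subset by (simp add: step_translate subsetD)
next
  case (Suc n)
  have "taboo (Suc n) (g \<otimes> x) (g \<otimes> y)
      = (\<integral>\<^sup>+z. taboo n (g \<otimes> x) (g \<otimes> z) * step (g \<otimes> z) (g \<otimes> y) \<partial>count_space (carrier G - H))"
    unfolding taboo.simps
    by (rule nn_integral_bij_count_space[OF bij_betw_translate_Diff[OF assms], symmetric])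
  also have "\<dots> = taboo (Suc n) x y"
    unfolding taboo.simps
    using assms H_subset by (intro nn_integral_cong) (simp add: Suc step_translate subsetD)
  finally show ?case .
qed

text \<open>Optional stopping at the first return to \<open>H\<close>, truncated at time \<open>n + 1\<close>.\<close>

lemma harmonic_decomposition:
  assumes F: "\<And>x. x \<in> carrier G \<Longrightarrow> F x = (\<integral>\<^sup>+s. F (x \<otimes> s) \<partial>measure_pmf m)"
    and x: "x \<in> carrier G"
  shows "F x = (\<Sum>j<Suc n. \<integral>\<^sup>+h. taboo j x h * F h \<partial>count_space H)
    + (\<integral>\<^sup>+y. taboo n x y * F y \<partial>count_space (carrier G - H))"
proof (induction n)
  have split: "(\<integral>\<^sup>+y. f y \<partial>count_space (carrier G))
      = (\<integral>\<^sup>+y. f y \<partial>count_space H) + (\<integral>\<^sup>+y. f y \<partial>count_space (carrier G - H))" for f :: "'a \<Rightarrow> ennreal"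
    using nn_integral_count_space_Un_disjoint[of H "carrier G - H" f] H_subset
    by (simp add: Un_absorb1)
  have F': "F y = (\<integral>\<^sup>+z. step y z * F z \<partial>count_space (carrier G))" if "y \<in> carrier G" for y
    using F[OF that] nn_integral_step[OF that, of F] by simp
  {
    case 0
    show ?case
      using F'[OF x] split[of "\<lambda>z. step x z * F z"] by simp
  next
    case (Suc n)
    let ?C = "count_space (carrier G - H)"
    \<comment> \<open>Harmonicity lets the mass still outside \<open>H\<close> make one more step;
      splitting the new end point moves the part that has returned into the sum.\<close>
    have "(\<integral>\<^sup>+y. taboo n x y * F y \<partial>?C)
        = (\<integral>\<^sup>+y. \<integral>\<^sup>+z. taboo n x y * step y z * F z \<partial>count_space (carrier G) \<partial>?C)"
      by (intro nn_integral_cong) (simp add: F' nn_integral_cmult mult.assoc flip: F')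
    also have "\<dots> = (\<integral>\<^sup>+z. \<integral>\<^sup>+y. taboo n x y * step y z * F z \<partial>?C \<partial>count_space (carrier G))"
      by (rule nn_integral_count_space_swap)
    also have "\<dots> = (\<integral>\<^sup>+z. taboo (Suc n) x z * F z \<partial>count_space (carrier G))"
      by (simp add: nn_integral_multc)
    finally show ?case
      using Suc by (simp only: split sum.lessThan_Suc add.assoc)
  }
qed

text \<open>First-step recursion for the surviving mass, in the shape of the recursion defining
  \<open>avoidance_prob\<close>.\<close>

lemma taboo_mass_Suc:
  "(\<integral>\<^sup>+y. taboo (Suc n) x y \<partial>count_space (carrier G - H))
    = (\<integral>\<^sup>+z. step x z * (\<integral>\<^sup>+y. taboo n z y \<partial>count_space (carrier G - H)) \<partial>count_space (carrier G - H))"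
  unfolding taboo_Suc_left
  by (subst nn_integral_count_space_swap) (simp add: nn_integral_cmult)

lemma nn_integral_step_Diff:
  assumes "x \<in> carrier G"
  shows "(\<integral>\<^sup>+y. step x y * F y \<partial>count_space (carrier G - H))
    = (\<integral>\<^sup>+s. (if x \<otimes> s \<in> H then 0 else F (x \<otimes> s)) \<partial>measure_pmf m)"
proof -
  have "(\<integral>\<^sup>+y. step x y * F y \<partial>count_space (carrier G - H))
      = (\<integral>\<^sup>+y. step x y * (if y \<in> H then 0 else F y) \<partial>count_space (carrier G))"
    by (auto simp: nn_integral_count_space_indicator intro!: nn_integral_cong split: split_indicator)
  then show ?thesis
    using nn_integral_step[OF assms] by simp
qed

end

text \<open>The integral is the probability of avoiding \<open>H\<close> at times \<open>1\<close>
  to \<open>n + 1\<close>, so the assumption is almost sure return.\<close>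

locale recurrent_symmetric_walk = symmetric_walk +
  assumes recurrent: "(\<lambda>n. \<integral>\<^sup>+y. taboo n \<one> y \<partial>count_space (carrier G - H)) \<longlonglongrightarrow> 0"
begin

text \<open>Since \<open>F \<le> 1\<close>, the remainder in the truncated identity is at most the
  surviving mass and vanishes in the limit.\<close>

lemma harmonic_first_return:
  assumes F: "\<And>x. x \<in> carrier G \<Longrightarrow> F x = (\<integral>\<^sup>+s. F (x \<otimes> s) \<partial>measure_pmf m)"
    and F1: "\<And>x. x \<in> carrier G \<Longrightarrow> F x \<le> 1"
  shows "(\<integral>\<^sup>+h. first_return h * F h \<partial>count_space H) = F \<one>"
proof -
  let ?a = "\<lambda>j. \<integral>\<^sup>+h. taboo j \<one> h * F h \<partial>count_space H"
  let ?r = "\<lambda>n. \<integral>\<^sup>+y. taboo n \<one> y * F y \<partial>count_space (carrier G - H)"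
  have "?r \<longlonglongrightarrow> 0"
  proof (rule tendsto_sandwich[OF _ _ tendsto_const recurrent])
    have "taboo n \<one> y * F y \<le> taboo n \<one> y" if "y \<in> carrier G - H" for n y
      using mult_left_mono[OF F1[of y], of "taboo n \<one> y"] that by simp
    then show "\<forall>\<^sub>F n in sequentially. ?r n \<le> (\<integral>\<^sup>+y. taboo n \<one> y \<partial>count_space (carrier G - H))"
      by (intro always_eventually allI nn_integral_mono) simp
  qed simp
  moreover have "(\<lambda>n. \<Sum>j<Suc n. ?a j) \<longlonglongrightarrow> (\<Sum>j. ?a j)"
    by (intro LIMSEQ_Suc summable_LIMSEQ) simp
  ultimately have "(\<lambda>n. (\<Sum>j<Suc n. ?a j) + ?r n) \<longlonglongrightarrow> (\<Sum>j. ?a j) + 0"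
    by (intro tendsto_add)
  then have "(\<lambda>n. F \<one>) \<longlonglongrightarrow> (\<Sum>j. ?a j)"
    using harmonic_decomposition[of F, OF F one_closed] by simp
  then have "(\<Sum>j. ?a j) = F \<one>"
    using LIMSEQ_unique tendsto_const by blast
  then show ?thesis
    by (simp add: first_return_def nn_integral_suminf[symmetric])
qed

lemma first_return_total: "(\<integral>\<^sup>+h. first_return h \<partial>count_space H) = 1"
  using harmonic_first_return[of "\<lambda>_. 1"] by simp

section \<open>The law of the first return\<close>

definition hitting_pmf :: "'a pmf" where
  "hitting_pmf = embed_pmf (\<lambda>h. if h \<in> H then enn2real (first_return h) else 0)"

lemma first_return_finite:
  assumes "h \<in> H"
  shows "first_return h < \<top>"
proof -
  have "first_return h \<le> (\<integral>\<^sup>+h. first_return h \<partial>count_space H)"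
    using nn_integral_ge_point[OF assms] .
  then show ?thesis
    by (simp add: first_return_total le_less_trans)
qed

lemma pmf_hitting_pmf:
  "pmf hitting_pmf h = (if h \<in> H then enn2real (first_return h) else 0)"
  unfolding hitting_pmf_def
proof (rule pmf_embed_pmf)
  have "(\<integral>\<^sup>+h. ennreal (if h \<in> H then enn2real (first_return h) else 0) \<partial>count_space UNIV)
      = (\<integral>\<^sup>+h. first_return h \<partial>count_space H)"
    by (subst (2) nn_integral_count_space_indicator)
       (auto intro!: nn_integral_cong simp: first_return_finite split: split_indicator)
  then show "(\<integral>\<^sup>+h. ennreal (if h \<in> H then enn2real (first_return h) else 0) \<partial>count_space UNIV) = 1"
    by (simp add: first_return_total)
qed simp

lemma ennreal_pmf_hitting_pmf:
  "ennreal (pmf hitting_pmf h) = (if h \<in> H then first_return h else 0)"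
  by (simp add: pmf_hitting_pmf first_return_finite)

lemma set_hitting_pmf_subset: "set_pmf hitting_pmf \<subseteq> H"
  by (auto simp: set_pmf_iff pmf_hitting_pmf split: if_splits)

text \<open>Translating by \<open>h\<close> carries paths from \<open>\<one>\<close> to
  \<open>inv h\<close> to paths from \<open>h\<close> to \<open>\<one>\<close>, and reversal makes
  them paths from \<open>\<one>\<close> to \<open>h\<close>.\<close>

lemma symmetric_hitting_pmf: "symmetric_pmf (G\<lparr>carrier := H\<rparr>) hitting_pmf"
proof -
  have "pmf hitting_pmf (inv h) = pmf hitting_pmf h" if h: "h \<in> H" for h
  proof -
    have hG: "h \<in> carrier G" and inv: "inv h \<in> H"
      using h H_subset subgroup_H by (auto simp: subgroup.m_inv_closed)
    have "taboo n \<one> (inv h) = taboo n \<one> h" for n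
    proof -
      have "taboo n \<one> (inv h) = taboo n (h \<otimes> \<one>) (h \<otimes> inv h)"
        using h hG by (subst taboo_translate) auto
      also have "\<dots> = taboo n \<one> h"
        using hG by (simp add: taboo_sym)
      finally show ?thesis .
    qed
    then show ?thesis
      using h inv by (simp add: pmf_hitting_pmf first_return_def)
  qed
  then show ?thesis
    using m_inv_consistent[OF subgroup_H] by (simp add: symmetric_pmf_def)
qed

lemma in_set_hitting_pmf:
  assumes "h \<in> H" "taboo n \<one> h \<noteq> 0"
  shows "h \<in> set_pmf hitting_pmf"
proof -
  have "taboo n \<one> h \<le> first_return h"
    unfolding first_return_def using sum_le_suminf[of "\<lambda>n. taboo n \<one> h" "{n}"] by simp
  then have "ennreal (pmf hitting_pmf h) \<noteq> 0"
    using assms by (auto simp: ennreal_pmf_hitting_pmf)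
  then show ?thesis
    by (auto simp: set_pmf_iff)
qed

end

section \<open>Words in the generators\<close>

lemma (in group) foldr_mult_closed:
  assumes "set w \<subseteq> carrier G"
  shows "foldr (\<otimes>) w \<one> \<in> carrier G"
  using assms by (induction w) auto

lemma (in group) foldr_mult_append:
  assumes "set v \<subseteq> carrier G" "set w \<subseteq> carrier G"
  shows "foldr (\<otimes>) (v @ w) \<one> = foldr (\<otimes>) v \<one> \<otimes> foldr (\<otimes>) w \<one>"
  using assms by (induction v) (auto simp: m_assoc foldr_mult_closed)

lemma (in group) generate_word:
  assumes "S \<subseteq> carrier G" "g \<in> generate G S"
  shows "\<exists>w. set w \<subseteq> S \<union> (\<lambda>s. inv s) ` S \<and> foldr (\<otimes>) w \<one> = g"
  using assms(2)
proof (induction rule: generate.induct)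
  case one
  show ?case
    by (rule exI[of _ "[]"]) simp
next
  case (incl h)
  then show ?case
    using assms(1) by (intro exI[of _ "[h]"]) auto
next
  case (inv h)
  then show ?case
    using assms(1) by (intro exI[of _ "[inv h]"]) auto
next
  case (eng h1 h2)
  then obtain v w where "set v \<subseteq> S \<union> (\<lambda>s. inv s) ` S" "foldr (\<otimes>) v \<one> = h1"
    "set w \<subseteq> S \<union> (\<lambda>s. inv s) ` S" "foldr (\<otimes>) w \<one> = h2"
    by blast
  moreover have "S \<union> (\<lambda>s. inv s) ` S \<subseteq> carrier G"
    using assms(1) by auto
  ultimately show ?case
    using foldr_mult_append[of v w] by (intro exI[of _ "v @ w"]) auto
qed

text \<open>Subadditivity along a shortest word. It transfers the moment of the word length to the
  coordinates of the quotient.\<close>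

lemma (in group) word_length_linear_bound:
  fixes \<rho> :: "'a \<Rightarrow> real"
  assumes S: "finite S" "S \<subseteq> carrier G" "generate G S = carrier G"
    and \<rho>: "\<rho> \<one> \<le> 0" "\<And>x. 0 \<le> \<rho> x"
      "\<And>x y. x \<in> carrier G \<Longrightarrow> y \<in> carrier G \<Longrightarrow> \<rho> (x \<otimes> y) \<le> \<rho> x + \<rho> y"
  shows "\<exists>C\<ge>0. \<forall>g\<in>carrier G. \<rho> g \<le> C * real (word_length G S g)"
proof -
  define L where "L = S \<union> (\<lambda>s. inv s) ` S"
  have L: "finite L" "L \<subseteq> carrier G"
    using S by (auto simp: L_def)
  define C where "C = sum \<rho> L"
  have C: "\<rho> s \<le> C" if "s \<in> L" for s
    unfolding C_def using L \<rho>(2) that by (intro member_le_sum) auto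
  have bound: "\<rho> (foldr (\<otimes>) w \<one>) \<le> C * real (length w)" if "set w \<subseteq> L" for w
    using that
  proof (induction w)
    case (Cons s w)
    have "\<rho> (foldr (\<otimes>) (s # w) \<one>) \<le> \<rho> s + \<rho> (foldr (\<otimes>) w \<one>)"
      using Cons.prems L foldr_mult_closed[of w] by (auto intro!: \<rho>(3))
    also have "\<dots> \<le> C + C * real (length w)"
      using Cons C[of s] by (intro add_mono) auto
    finally show ?case
      by (simp add: algebra_simps)
  qed (use \<rho>(1) in simp)
  have "\<rho> g \<le> C * real (word_length G S g)" if g: "g \<in> carrier G" for g
  proof -
    let ?P = "\<lambda>n. \<exists>w. length w = n \<and> set w \<subseteq> L \<and> foldr (\<otimes>) w \<one> = g"
    \<comment> \<open>Some word exists because \<open>S\<close> generates; only then does the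
      \<open>LEAST\<close> in \<open>word_length\<close> denote an attained length.\<close>
    obtain w where "set w \<subseteq> L" "foldr (\<otimes>) w \<one> = g"
      using generate_word[of S g] S g unfolding L_def by blast
    then have "?P (length w)"
      by blast
    then have "?P (LEAST n. ?P n)"
      by (rule LeastI)
    then have "?P (word_length G S g)"
      unfolding word_length_def L_def .
    then obtain v where "length v = word_length G S g" "set v \<subseteq> L" "foldr (\<otimes>) v \<one> = g"
      by blast
    with bound[of v] show ?thesis
      by simp
  qed
  moreover have "0 \<le> C"
    unfolding C_def by (intro sum_nonneg \<rho>(2))
  ultimately show ?thesis
    by blast
qed

section \<open>Projection to an abelian quotient\<close>

context symmetric_walk
begin

text \<open>By symmetry inverse letters carry mass as well, so every word in the generated group is
  a path of the walk.\<close>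

lemma pmf_pos_of_letter:
  assumes "s \<in> set_pmf m \<union> (\<lambda>s. inv s) ` set_pmf m"
  shows "s \<in> carrier G" "pmf m s > 0"
  using assms supp sym by (auto simp: symmetric_pmf_def pmf_positive)

text \<open>Inversion is injective on the carrier but possibly not on the type, so the masses are
  compared separately on and off the inverted support.\<close>

lemma map_pmf_inv: "map_pmf (\<lambda>s. inv s) m = m"
proof (rule pmf_eqI)
  fix g
  show "pmf (map_pmf (\<lambda>s. inv s) m) g = pmf m g"
  proof (cases "g \<in> (\<lambda>s. inv s) ` set_pmf m")
    case True
    then obtain s where s: "s \<in> set_pmf m" "g = inv s"
      by blast
    have "inj_on (\<lambda>s. inv s) (set_pmf m)"
      using supp inj_on_subset[OF inv_inj] by blast
    then have "pmf (map_pmf (\<lambda>s. inv s) m) g = pmf m s"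
      using s by (simp add: pmf_map_inj)
    also have "\<dots> = pmf m g"
      using s sym supp by (auto simp: symmetric_pmf_def)
    finally show ?thesis .
  next
    case False
    have "g \<notin> set_pmf m"
    proof
      assume g: "g \<in> set_pmf m"
      then have "inv g \<in> set_pmf m" "g = inv (inv g)"
        using pmf_pos_of_letter[of "inv g"] supp by (auto simp: set_pmf_iff)
      with False show False
        by blast
    qed
    then have "pmf m g = 0"
      by (simp add: pmf_eq_0_set_pmf)
    moreover have "pmf (map_pmf (\<lambda>s. inv s) m) g = 0"
      unfolding pmf_eq_0_set_pmf using False by simp
    ultimately show ?thesis
      by simp
  qed
qed

context
  fixes \<pi> :: "'a \<Rightarrow> 'c::ab_group_add"
  assumes hom: "\<And>x y. x \<in> carrier G \<Longrightarrow> y \<in> carrier G \<Longrightarrow> \<pi> (x \<otimes> y) = \<pi> x + \<pi> y"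
    and kernel: "\<And>x. x \<in> carrier G \<Longrightarrow> \<pi> x = 0 \<longleftrightarrow> x \<in> H"
begin

lemma proj_one: "\<pi> \<one> = 0"
  using kernel[of \<one>] subgroup_H by (simp add: subgroup.one_closed)

lemma proj_inv:
  assumes "x \<in> carrier G"
  shows "\<pi> (inv x) = - \<pi> x"
  using hom[of "inv x" x] assms proj_one by (simp add: eq_neg_iff_add_eq_0)

lemma map_pmf_proj_sym: "pmf (map_pmf \<pi> m) (- z) = pmf (map_pmf \<pi> m) z"
proof -
  have "map_pmf uminus (map_pmf \<pi> m) = map_pmf \<pi> (map_pmf (\<lambda>s. inv s) m)"
    unfolding pmf.map_comp
    by (intro map_pmf_cong) (use supp proj_inv in auto)
  then have "map_pmf uminus (map_pmf \<pi> m) = map_pmf \<pi> m"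
    by (simp only: map_pmf_inv)
  moreover have "pmf (map_pmf uminus (map_pmf \<pi> m)) (- z) = pmf (map_pmf \<pi> m) z"
    by (rule pmf_map_inj') simp
  ultimately show ?thesis
    by simp
qed

text \<open>Lying in \<open>H\<close> means projecting to zero, so both sides obey the same
  recursion. The \<open>Suc n\<close> reflects that \<open>taboo n\<close> makes
  \<open>n + 1\<close> steps.\<close>

lemma taboo_mass_eq_avoidance_prob:
  "x \<in> carrier G \<Longrightarrow> (\<integral>\<^sup>+y. taboo n x y \<partial>count_space (carrier G - H))
    = ennreal (avoidance_prob (map_pmf \<pi> m) (Suc n) (\<pi> x))"
proof (induction n arbitrary: x)
  have avoid: "ennreal (avoidance_prob (map_pmf \<pi> m) (Suc n) (\<pi> x))
      = (\<integral>\<^sup>+s. (if x \<otimes> s \<in> H then 0 else ennreal (avoidance_prob (map_pmf \<pi> m) n (\<pi> (x \<otimes> s)))) \<partial>measure_pmf m)"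
    if x: "x \<in> carrier G" for n x
  proof -
    let ?a = "\<lambda>s. if \<pi> x + \<pi> s = 0 then 0 else avoidance_prob (map_pmf \<pi> m) n (\<pi> x + \<pi> s)"
    have a: "0 \<le> ?a s" "?a s \<le> 1" for s
      using avoidance_prob_bounds[of "map_pmf \<pi> m" n] by auto
    have "ennreal (avoidance_prob (map_pmf \<pi> m) (Suc n) (\<pi> x)) = ennreal (measure_pmf.expectation m ?a)"
      by simp
    also have "\<dots> = (\<integral>\<^sup>+s. ennreal (?a s) \<partial>measure_pmf m)"
      by (intro nn_integral_eq_integral[symmetric] integrable_pmf_bounded[where B = 1]) (use a in auto)
    also have "\<dots> = (\<integral>\<^sup>+s. (if x \<otimes> s \<in> H then 0
        else ennreal (avoidance_prob (map_pmf \<pi> m) n (\<pi> (x \<otimes> s)))) \<partial>measure_pmf m)"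
      by (intro nn_integral_cong_AE) (use supp x in \<open>auto simp: AE_measure_pmf_iff hom kernel[symmetric]\<close>)
    finally show ?thesis .
  qed
  {
    case 0
    then show ?case
      using nn_integral_step_Diff[of x "\<lambda>_. 1"] avoid[of x 0, unfolded avoidance_prob.simps(1)]
      by (simp del: avoidance_prob.simps cong: if_cong)
  next
    case (Suc n)
    have "(\<integral>\<^sup>+y. taboo (Suc n) x y \<partial>count_space (carrier G - H))
        = (\<integral>\<^sup>+z. step x z * ennreal (avoidance_prob (map_pmf \<pi> m) (Suc n) (\<pi> z)) \<partial>count_space (carrier G - H))"
      unfolding taboo_mass_Suc by (intro nn_integral_cong) (simp add: Suc.IH del: avoidance_prob.simps)
    also have "\<dots> = ennreal (avoidance_prob (map_pmf \<pi> m) (Suc (Suc n)) (\<pi> x))"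
      unfolding nn_integral_step_Diff[OF Suc.prems] avoid[OF Suc.prems] ..
    finally show ?case .
  }
qed

lemma recurrent_if_projection_recurrent:
  assumes "(\<lambda>n. avoidance_prob (map_pmf \<pi> m) n 0) \<longlonglongrightarrow> 0"
  shows "recurrent_symmetric_walk G H m"
proof
  have "(\<lambda>n. ennreal (avoidance_prob (map_pmf \<pi> m) (Suc n) 0)) \<longlonglongrightarrow> ennreal 0"
    using LIMSEQ_Suc[OF assms] by (rule tendsto_ennrealI)
  then show "(\<lambda>n. \<integral>\<^sup>+y. taboo n \<one> y \<partial>count_space (carrier G - H)) \<longlonglongrightarrow> 0"
    using taboo_mass_eq_avoidance_prob[OF one_closed] by (simp add: proj_one del: avoidance_prob.simps)
qed

end

end

section \<open>Generation and stationarity\<close>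

context recurrent_symmetric_walk
begin

lemma taboo_Suc_ne_0:
  assumes "z \<in> carrier G - H" "taboo n x z \<noteq> 0" "step z y \<noteq> 0"
  shows "taboo (Suc n) x y \<noteq> 0"
proof -
  have "taboo n x z * step z y \<le> taboo (Suc n) x y"
    unfolding taboo.simps by (rule nn_integral_ge_point[OF assms(1)])
  with assms show ?thesis
    by auto
qed

lemma generate_set_hitting_pmf:
  assumes gen: "generate G (set_pmf m) = carrier G"
  shows "generate G (set_pmf hitting_pmf) = H"
proof
  show "generate G (set_pmf hitting_pmf) \<subseteq> H"
    by (rule generate_subgroup_incl[OF set_hitting_pmf_subset subgroup_H])
  define K where "K = generate G (set_pmf hitting_pmf)"
  have K: "subgroup K G" "K \<subseteq> H"
    unfolding K_def using set_hitting_pmf_subset H_subset subgroup_H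
    by (intro generate_is_subgroup generate_subgroup_incl; blast)+
  have K_carrier: "k \<in> carrier G" if "k \<in> K" for k
    using that K(2) H_subset by blast
  \<comment> \<open>Invariant along words in the support: the current point lies in \<open>K\<close> or on an excursion
    outside \<open>H\<close> that started in \<open>K\<close>.\<close>
  define reached where "reached g \<longleftrightarrow> g \<in> K \<or>
    g \<in> carrier G - H \<and> (\<exists>k\<in>K. \<exists>n. taboo n k g \<noteq> 0)" for g
  \<comment> \<open>Translation by \<open>inv k\<close> moves the start of the excursion to the
    identity; if it ends in \<open>H\<close>, then \<open>inv k \<otimes> g\<close> has positive
    return weight and lies in \<open>K\<close>.\<close>
  have return: "reached g" if "k \<in> K" "taboo n k g \<noteq> 0" "g \<in> carrier G" for k n g
  proof (cases "g \<in> H")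
    case True
    have k: "k \<in> carrier G" "inv k \<in> K" "inv k \<in> H"
      using K_carrier K that(1) by (auto simp: subgroup.m_inv_closed)
    have "taboo n (inv k \<otimes> k) (inv k \<otimes> g) \<noteq> 0"
      using taboo_translate[OF k(3) k(1) that(3), of n] that(2) by simp
    then have "taboo n \<one> (inv k \<otimes> g) \<noteq> 0"
      using k by simp
    moreover have "inv k \<otimes> g \<in> H"
      using k(3) True subgroup_H by (simp add: subgroup.m_closed)
    ultimately have "inv k \<otimes> g \<in> K"
      unfolding K_def by (intro generate.incl in_set_hitting_pmf)
    then have "k \<otimes> (inv k \<otimes> g) \<in> K"
      using K(1) that(1) by (simp add: subgroup.m_closed)
    then show ?thesis
      using k that(3) by (simp add: reached_def m_assoc[symmetric])
  qed (use that in \<open>auto simp: reached_def\<close>)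
  have extend: "reached (g \<otimes> s)" if g: "reached g" and s: "s \<in> carrier G" "pmf m s > 0" for g s
  proof -
    have gG: "g \<in> carrier G"
      using g K_carrier by (auto simp: reached_def)
    have "step g (g \<otimes> s) = ennreal (pmf m s)"
      using gG s by (simp add: step_def m_assoc[symmetric])
    then have step: "step g (g \<otimes> s) \<noteq> 0"
      using s by simp
    from g consider "g \<in> K" | k n where "g \<in> carrier G - H" "k \<in> K" "taboo n k g \<noteq> 0"
      by (auto simp: reached_def)
    then show ?thesis
    proof cases
      case 1
      then show ?thesis
        using return[of g 0 "g \<otimes> s"] step gG s by simp
    next
      case 2
      then show ?thesis
        using return[OF 2(2) taboo_Suc_ne_0[OF 2(1,3) step]] gG s by simp
    qed
  qed
  have word: "reached (g \<otimes> foldr (\<otimes>) w \<one>)"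
    if "reached g" "set w \<subseteq> set_pmf m \<union> (\<lambda>s. inv s) ` set_pmf m" for g w
    using that
  proof (induction w arbitrary: g)
    case Nil
    then have "g \<in> carrier G"
      using K_carrier by (auto simp: reached_def)
    with Nil show ?case
      by simp
  next
    case (Cons s w)
    have s: "s \<in> carrier G" "pmf m s > 0"
      using Cons.prems(2) by (intro pmf_pos_of_letter; simp)+
    have "set w \<subseteq> carrier G"
      using Cons.prems(2) pmf_pos_of_letter(1) by auto
    then have "g \<otimes> foldr (\<otimes>) (s # w) \<one> = g \<otimes> s \<otimes> foldr (\<otimes>) w \<one>"
      using s Cons.prems(1) K_carrier by (auto simp: reached_def m_assoc foldr_mult_closed)
    moreover have "reached (g \<otimes> s \<otimes> foldr (\<otimes>) w \<one>)"
      using Cons.prems by (intro Cons.IH extend s) auto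
    ultimately show ?case
      by simp
  qed
  show "H \<subseteq> generate G (set_pmf hitting_pmf)"
  proof
    fix h assume h: "h \<in> H"
    then obtain w where w: "set w \<subseteq> set_pmf m \<union> (\<lambda>s. inv s) ` set_pmf m" "foldr (\<otimes>) w \<one> = h"
      using generate_word[OF supp] gen H_subset by blast
    have "reached \<one>"
      unfolding reached_def using subgroup.one_closed[OF K(1)] by simp
    from word[OF this w(1)] have "reached h"
      using w h H_subset by auto
    \<comment> \<open>The other alternative in \<open>reached\<close> would place \<open>h\<close>
      outside \<open>H\<close>.\<close>
    then show "h \<in> generate G (set_pmf hitting_pmf)"
      using h by (simp add: reached_def K_def)
  qed
qed

lemma stationary_hitting_pmf:
  fixes \<phi> :: "'a \<Rightarrow> 'y \<Rightarrow> 'y" and \<nu> :: "'y measure"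
  assumes act: "group_action G (space \<nu>) \<phi>"
    and meas: "\<And>g. g \<in> carrier G \<Longrightarrow> \<phi> g \<in> measurable \<nu> \<nu>"
    and "prob_space \<nu>"
    and stat: "stationary \<phi> m \<nu>"
  shows "stationary \<phi> hitting_pmf \<nu>"
proof -
  interpret \<nu>: prob_space \<nu>
    by fact
  interpret act: group_action G "space \<nu>" \<phi>
    by fact
  have "emeasure (convolution_action \<phi> hitting_pmf \<nu>) A = emeasure \<nu> A" if A: "A \<in> sets \<nu>" for A
  proof -
    \<comment> \<open>\<open>F g\<close> is the measure of \<open>g^-1 A\<close>, written as a
      preimage. Preimages reverse composition, so applying stationarity at \<open>x\<close> appends
      \<open>s\<close> on the right, as the walk does.\<close>
    define F where "F g = emeasure \<nu> (\<phi> g -` A \<inter> space \<nu>)" for g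
    have distr: "emeasure (distr \<nu> \<nu> (\<phi> g)) B = emeasure \<nu> (\<phi> g -` B \<inter> space \<nu>)"
      if "g \<in> carrier G" "B \<in> sets \<nu>" for g B
      using that by (simp add: emeasure_distr meas)
    have harmonic: "F x = (\<integral>\<^sup>+s. F (x \<otimes> s) \<partial>measure_pmf m)" if x: "x \<in> carrier G" for x
    proof -
      let ?B = "\<phi> x -` A \<inter> space \<nu>"
      have B: "?B \<in> sets \<nu>"
        using measurable_sets[OF meas[OF x] A] .
      have shift: "\<phi> s -` ?B \<inter> space \<nu> = \<phi> (x \<otimes> s) -` A \<inter> space \<nu>" if "s \<in> carrier G" for s
        using act.composition_rule[OF _ x that] act.element_image[OF that] by auto
      have "F x = emeasure (convolution_action \<phi> m \<nu>) ?B"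
        using stat by (simp add: F_def stationary_def)
      also have "\<dots> = (\<integral>\<^sup>+s. emeasure (distr \<nu> \<nu> (\<phi> s)) ?B \<partial>measure_pmf m)"
        by (simp add: emeasure_convolution_action[OF B] nn_integral_measure_pmf)
      also have "\<dots> = (\<integral>\<^sup>+s. F (x \<otimes> s) \<partial>measure_pmf m)"
      proof (intro nn_integral_cong_AE AE_pmfI)
        fix s assume "s \<in> set_pmf m"
        then have "s \<in> carrier G"
          using supp by blast
        then show "emeasure (distr \<nu> \<nu> (\<phi> s)) ?B = F (x \<otimes> s)"
          using distr[OF _ B, of s] shift[of s] by (simp add: F_def)
      qed
      finally show ?thesis .
    qed
    have "emeasure (convolution_action \<phi> hitting_pmf \<nu>) A
        = (\<integral>\<^sup>+g. ennreal (pmf hitting_pmf g) * emeasure (distr \<nu> \<nu> (\<phi> g)) A \<partial>count_space UNIV)"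
      by (rule emeasure_convolution_action[OF A])
    also have "\<dots> = (\<integral>\<^sup>+g. first_return g * F g * indicator H g \<partial>count_space UNIV)"
      using distr[OF _ A] H_subset
      by (intro nn_integral_cong) (auto simp: ennreal_pmf_hitting_pmf F_def split: split_indicator)
    also have "\<dots> = (\<integral>\<^sup>+h. first_return h * F h \<partial>count_space H)"
      by (simp add: nn_integral_count_space_indicator)
    also have "\<dots> = F \<one>"
      by (rule harmonic_first_return[OF harmonic]) (auto simp: F_def \<nu>.emeasure_le_1)
    also have "\<dots> = emeasure \<nu> A"
    proof -
      have "\<phi> \<one> y = y" if "y \<in> space \<nu>" for y
        using act.id_eq_one that by (metis restrict_apply')
      then have "\<phi> \<one> -` A \<inter> space \<nu> = A"
        using sets.sets_into_space[OF A] by auto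
      then show ?thesis
        by (simp add: F_def)
    qed
    finally show ?thesis .
  qed
  then show ?thesis
    unfolding stationary_def by (intro measure_eqI) auto
qed

end

section \<open>Finite moments and the coordinates of the quotient\<close>

lemma space_borel_algebra [simp]: "space (borel_algebra Y) = topspace Y"
  by (simp add: borel_algebra_def space_measure_of_conv)

lemma measurable_homeomorphic_map:
  assumes "homeomorphic_map Y Y f" "sets \<nu> = sets (borel_algebra Y)"
  shows "f \<in> measurable \<nu> \<nu>"
proof (rule measurable_sigma_sets)
  have opens: "{U. openin Y U} \<subseteq> Pow (topspace Y)"
    by (auto dest: openin_subset)
  then show sets: "sets \<nu> = sigma_sets (topspace Y) {U. openin Y U}"
    using assms(2) by (simp add: borel_algebra_def)
  show "{U. openin Y U} \<subseteq> Pow (topspace Y)"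
    by (rule opens)
  have space: "space \<nu> = topspace Y"
    using sets_eq_imp_space_eq[OF assms(2)] by simp
  have cont: "continuous_map Y Y f"
    using assms(1) by (rule homeomorphic_imp_continuous_map)
  then show "f \<in> space \<nu> \<rightarrow> topspace Y"
    by (simp add: space continuous_map_def)
  fix U assume "U \<in> {U. openin Y U}"
  then have "openin Y {x \<in> topspace Y. f x \<in> U}"
    using cont by (simp add: openin_continuous_map_preimage)
  moreover have "{x \<in> topspace Y. f x \<in> U} = f -` U \<inter> space \<nu>"
    by (auto simp: space)
  ultimately show "f -` U \<inter> space \<nu> \<in> sets \<nu>"
    by (auto simp: sets intro: sigma_sets.Basic)
qed

text \<open>Unconditional summability of reals is absolute, which turns the moment hypothesis into
  Bochner integrability.\<close>

lemma integrable_pmf_if_summable_on: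
  fixes f :: "'a \<Rightarrow> real"
  assumes "(\<lambda>x. f x * pmf p x) summable_on A" "set_pmf p \<subseteq> A"
  shows "integrable (measure_pmf p) f"
proof -
  have "(\<lambda>x. f x * pmf p x) summable_on UNIV"
    using assms(1)
    by (rule summable_on_cong_neutral[THEN iffD1, rotated -1])
      (use assms(2) in \<open>auto simp: set_pmf_iff\<close>)
  then have "Infinite_Sum.abs_summable_on (\<lambda>x. f x * pmf p x) UNIV"
    by (rule summable_on_iff_abs_summable_on_real[THEN iffD1])
  then have "integrable (count_space UNIV) (\<lambda>x. f x * pmf p x)"
    by (simp only: abs_summable_equivalent abs_summable_on_def)
  then show ?thesis
    unfolding measure_pmf_eq_density by (subst integrable_density) (auto simp: mult.commute)
qed

lemma quotient_coordinates:
  assumes "H \<lhd> G" "(G Mod H) \<cong> product_group {..<k} (\<lambda>_. integer_group)"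
  shows "\<exists>q :: 'g \<Rightarrow> nat \<Rightarrow> int.
    (\<forall>x\<in>carrier G. \<forall>y\<in>carrier G. \<forall>i<k. q (x \<otimes>\<^bsub>G\<^esub> y) i = q x i + q y i) \<and>
    (\<forall>x\<in>carrier G. (\<forall>i<k. q x i = 0) \<longleftrightarrow> x \<in> H)"
proof -
  interpret normal H G
    by fact
  let ?Z = "product_group {..<k} (\<lambda>_. integer_group)"
  obtain h where h: "h \<in> iso (G Mod H) ?Z"
    using assms(2) by (auto simp: is_iso_def)
  define q where "q x = h (H #>\<^bsub>G\<^esub> x)" for x
  have Z: "group ?Z"
    by simp
  have h_hom: "h \<in> hom (G Mod H) ?Z" and h_inj: "inj_on h (carrier (G Mod H))"
    using h by (auto simp: iso_def bij_betw_def)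
  have coset: "H #>\<^bsub>G\<^esub> x \<in> carrier (G Mod H)" if "x \<in> carrier G" for x
    using that by (simp add: carrier_FactGroup)
  have "q (x \<otimes>\<^bsub>G\<^esub> y) i = q x i + q y i" if "x \<in> carrier G" "y \<in> carrier G" "i < k" for x y i
  proof -
    have "q (x \<otimes>\<^bsub>G\<^esub> y) = q x \<otimes>\<^bsub>?Z\<^esub> q y"
      unfolding q_def using hom_mult[OF h_hom coset coset, of x y] that by (simp add: rcos_sum)
    then show ?thesis
      using that(3) by (simp add: integer_group_def)
  qed
  moreover have "(\<forall>i<k. q x i = 0) \<longleftrightarrow> x \<in> H" if x: "x \<in> carrier G" for x
  proof -
    \<comment> \<open>Membership in the extensional product fixes the values at indices from
      \<open>k\<close> on, so vanishing below \<open>k\<close> already identifies the unit.\<close>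
    have "q x \<in> carrier ?Z"
      unfolding q_def using h_hom coset[OF x] by (rule hom_in_carrier)
    then have "(\<forall>i<k. q x i = 0) \<longleftrightarrow> q x = \<one>\<^bsub>?Z\<^esub>"
      by (auto simp: integer_group_def PiE_def extensional_def fun_eq_iff)
    also have "\<dots> \<longleftrightarrow> h (H #>\<^bsub>G\<^esub> x) = h \<one>\<^bsub>G Mod H\<^esub>"
      using hom_one[OF h_hom factorgroup_is_group Z] by (simp only: q_def)
    also have "\<dots> \<longleftrightarrow> H #>\<^bsub>G\<^esub> x = \<one>\<^bsub>G Mod H\<^esub>"
      by (rule inj_on_eq_iff[OF h_inj coset[OF x]
            monoid.one_closed[OF group.is_monoid[OF factorgroup_is_group]]])
    also have "\<dots> \<longleftrightarrow> x \<in> H"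
      using coset_join1[OF _ x subgroup_axioms] coset_join2[OF x subgroup_axioms] by auto
    finally show ?thesis .
  qed
  ultimately show ?thesis
    by (intro exI[of _ q]) simp
qed

theorem proposition6p1:
  fixes G :: "('g, 'b) monoid_scheme"
    and H S :: "'g set"
    and Y :: "'y topology"
    and \<phi> :: "'g \<Rightarrow> 'y \<Rightarrow> 'y"
    and k :: nat
    and m :: "'g pmf"
    and \<nu> :: "'y measure"
  assumes "group G"
    and "finite S" and "S \<subseteq> carrier G" and "generate G S = carrier G"
    and "compact_space Y" and "metrizable_space Y"
    and "homeomorphic_action G Y \<phi>"
    and "H \<lhd> G" and "k \<in> {1, 2}"
    and "(G Mod H) \<cong> product_group {..<k} (\<lambda>_. integer_group)"
    and "set_pmf m \<subseteq> carrier G" and "symmetric_pmf G m"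
    and "generate G (set_pmf m) = carrier G"
    and "prob_space \<nu>" and "sets \<nu> = sets (borel_algebra Y)"
    and "stationary \<phi> m \<nu>"
    and "(\<lambda>g. real (word_length G S g) ^ k * pmf m g) summable_on carrier G"
  shows "\<exists>m' :: 'g pmf. set_pmf m' \<subseteq> H
           \<and> symmetric_pmf (G\<lparr>carrier := H\<rparr>) m'
           \<and> generate G (set_pmf m') = H
           \<and> stationary \<phi> m' \<nu>"
proof -
  interpret group G
    by fact
  have "subgroup H G"
    using \<open>H \<lhd> G\<close> by (rule normal.axioms)
  then interpret symmetric_walk G H m
    using assms(11,12) by (intro symmetric_walk.intro symmetric_walk_axioms.intro group_axioms)
  obtain q :: "'g \<Rightarrow> nat \<Rightarrow> int" where
    q: "\<forall>x\<in>carrier G. \<forall>y\<in>carrier G. \<forall>i<k. q (x \<otimes>\<^bsub>G\<^esub> y) i = q x i + q y i"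
      "\<forall>x\<in>carrier G. (\<forall>i<k. q x i = 0) \<longleftrightarrow> x \<in> H"
    using quotient_coordinates[OF \<open>H \<lhd> G\<close> assms(10)] by (elim exE conjE)
  have q_mult: "q (x \<otimes>\<^bsub>G\<^esub> y) i = q x i + q y i"
    if "x \<in> carrier G" "y \<in> carrier G" "i < k" for x y i
    using q(1) that by blast
  have q_kernel: "(\<forall>i<k. q x i = 0) \<longleftrightarrow> x \<in> H" if "x \<in> carrier G" for x
    using q(2) that by blast
  \<comment> \<open>The l1 norm of the projection is subadditive, hence at most linear in the word
    length; its \<open>k\<close>-th power dominates what each rank integrates.\<close>
  define \<rho> where "\<rho> x = (\<Sum>i<k. real_of_int \<bar>q x i\<bar>)" for x
  have \<rho>_nonneg: "0 \<le> \<rho> x" for x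
    by (simp add: \<rho>_def sum_nonneg)
  have "q \<one>\<^bsub>G\<^esub> i = 0" if "i < k" for i
    using q_mult[of "\<one>\<^bsub>G\<^esub>" "\<one>\<^bsub>G\<^esub>" i] that by simp
  then have \<rho>_one: "\<rho> \<one>\<^bsub>G\<^esub> \<le> 0"
    by (simp add: \<rho>_def)
  have \<rho>_mult: "\<rho> (x \<otimes>\<^bsub>G\<^esub> y) \<le> \<rho> x + \<rho> y" if "x \<in> carrier G" "y \<in> carrier G" for x y
    unfolding \<rho>_def sum.distrib[symmetric] using that by (intro sum_mono) (simp add: q_mult)
  obtain C where C: "0 \<le> C" "\<And>g. g \<in> carrier G \<Longrightarrow> \<rho> g \<le> C * real (word_length G S g)"
    using word_length_linear_bound[OF assms(2-4) \<rho>_one \<rho>_nonneg \<rho>_mult] by auto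
  have \<rho>_moment: "integrable (measure_pmf m) (\<lambda>g. \<rho> g ^ k)"
  proof (rule Bochner_Integration.integrable_bound)
    show "integrable (measure_pmf m) (\<lambda>g. C ^ k * real (word_length G S g) ^ k)"
      using integrable_pmf_if_summable_on[OF assms(17) assms(11)] by (rule integrable_mult_right)
    show "AE g in measure_pmf m. norm (\<rho> g ^ k) \<le> norm (C ^ k * real (word_length G S g) ^ k)"
    proof (rule AE_pmfI)
      fix g assume "g \<in> set_pmf m"
      then have "\<rho> g \<le> C * real (word_length G S g)"
        using C(2) assms(11) by blast
      then have "\<rho> g ^ k \<le> (C * real (word_length G S g)) ^ k"
        using \<rho>_nonneg by (rule power_mono)
      then show "norm (\<rho> g ^ k) \<le> norm (C ^ k * real (word_length G S g) ^ k)"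
        using C(1) \<rho>_nonneg[of g] by (simp add: power_mult_distrib)
    qed
  qed simp
  have "recurrent_symmetric_walk G H m"
  proof (cases "k = 1")
    case True
    define \<pi> where "\<pi> x = q x 0" for x
    have hom: "\<pi> (x \<otimes>\<^bsub>G\<^esub> y) = \<pi> x + \<pi> y" if "x \<in> carrier G" "y \<in> carrier G" for x y
      using that True by (simp add: \<pi>_def q_mult)
    have kernel: "\<pi> x = 0 \<longleftrightarrow> x \<in> H" if "x \<in> carrier G" for x
      using q_kernel[OF that] True by (simp add: \<pi>_def)
    have "integrable (measure_pmf (map_pmf \<pi> m)) (\<lambda>z. real_of_int \<bar>z\<bar>)"
      using \<rho>_moment True by (simp add: integrable_map_pmf_eq \<pi>_def \<rho>_def)
    then show ?thesis
      by (intro recurrent_if_projection_recurrent[OF hom kernel] recurrent_int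
          map_pmf_proj_sym[OF hom kernel])
  next
    case False
    then have k: "k = 2"
      using \<open>k \<in> {1, 2}\<close> by simp
    define \<pi> where "\<pi> x = (q x 0, q x 1)" for x
    have hom: "\<pi> (x \<otimes>\<^bsub>G\<^esub> y) = \<pi> x + \<pi> y" if "x \<in> carrier G" "y \<in> carrier G" for x y
      using that k by (simp add: \<pi>_def q_mult)
    have kernel: "\<pi> x = 0 \<longleftrightarrow> x \<in> H" if "x \<in> carrier G" for x
      using q_kernel[OF that] k by (auto simp: \<pi>_def zero_prod_def less_2_cases_iff)
    have "integrable (measure_pmf m) (\<lambda>g. (real_of_int (q g 0))\<^sup>2 + (real_of_int (q g 1))\<^sup>2)"
    proof (rule Bochner_Integration.integrable_bound[OF \<rho>_moment])
      have "\<rho> g = \<bar>real_of_int (q g 0)\<bar> + \<bar>real_of_int (q g 1)\<bar>" for g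
        by (simp add: \<rho>_def k numeral_2_eq_2)
      moreover have "a\<^sup>2 + b\<^sup>2 \<le> (\<bar>a\<bar> + \<bar>b\<bar>)\<^sup>2" for a b :: real
        by (simp add: power2_sum)
      ultimately show "AE g in measure_pmf m. norm ((real_of_int (q g 0))\<^sup>2 + (real_of_int (q g 1))\<^sup>2)
          \<le> norm (\<rho> g ^ k)"
        by (intro AE_I2) (simp add: k)
    qed simp
    then have "integrable (measure_pmf (map_pmf \<pi> m))
        (\<lambda>z. (real_of_int (fst z))\<^sup>2 + (real_of_int (snd z))\<^sup>2)"
      by (simp add: integrable_map_pmf_eq \<pi>_def)
    then show ?thesis
      by (intro recurrent_if_projection_recurrent[OF hom kernel] recurrent_int_prod
          map_pmf_proj_sym[OF hom kernel])
  qed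
  then interpret recurrent_symmetric_walk G H m .
  have space: "space \<nu> = topspace Y"
    using sets_eq_imp_space_eq[OF assms(15)] by simp
  show ?thesis
  proof (intro exI[of _ hitting_pmf] conjI)
    show "stationary \<phi> hitting_pmf \<nu>"
    proof (rule stationary_hitting_pmf)
      show "group_action G (space \<nu>) \<phi>"
        using assms(7) by (simp add: homeomorphic_action_def space)
      show "\<phi> g \<in> measurable \<nu> \<nu>" if "g \<in> carrier G" for g
        using assms(7,15) that by (intro measurable_homeomorphic_map) (auto simp: homeomorphic_action_def)
    qed fact+
  qed (fact set_hitting_pmf_subset symmetric_hitting_pmf generate_set_hitting_pmf[OF assms(13)])+
qed

end
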